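(* Let $(D,B,f,g)$ be a weak bialgebra with a weak projection onto the weak Hopf algebra $B$ (antipode $\lambda_B$). Let $t_B^D=\mu_D\circ(D\otimes(f\circ\lambda_B\circ g))\circ\delta_D$, which is idempotent, and let $t_B^D=i_B^D\circ p_B^D$ with $p_B^D:D\rightarrow D^B$, $i_B^D:D^B\rightarrow D$, $p_B^D\circ i_B^D=id_{D^B}$; $D^B$ is a coalgebra with coproduct $\delta_{D^B}=(p_B^D\otimes p_B^D)\circ\delta_D\circ i_B^D$ and counit $\varepsilon_{D^B}=\varepsilon_D\circ i_B^D$. Then $D$ is a weak crossed biproduct of the coalgebra $D^B$ with the algebra $B$ (i.e. with $C=D^B$ and $A=B$), where the morphisms are $\psi_B^{D^B}=(p_B^D\otimes g)\circ\delta_D\circ\mu_D\circ(f\otimes i_B^D)$, $\sigma_B^{D^B}=(p_B^D\otimes g)\circ\delta_D\circ\mu_D\circ(i_B^D\otimes i_B^D)$, $\chi_B^{D^B}=(g\otimes p_B^D)\circ\delta_D\circ\mu_D\circ(i_B^D\otimes f)$, $\tau_B^{D^B}=(g\otimes g)\circ\delta_D\circ\mu_D\circ(i_B^D\otimes f)$, the preunit and precounit are $\nu=(p_B^D\otimes g)\circ\delta_D\circ\eta_D$ and $\upsilon=\varepsilon_D\circ\mu_D\circ(i_B^D\otimes f)$, and, with $\nabla_{D^B\otimes B}$ the idempotent of this weak crossed biproduct, $\delta_{D^B\otimes B}$ its coproduct and $\beta_\nu=(D^B\otimes\mu_B)\circ(\nu\otimes B)$, the following identities hold: $\delta_{D^B\otimes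 B}\circ\beta_\nu=(\beta_\nu\otimes\beta_\nu)\circ\delta_B$, $\tau_B^{D^B}=(\varepsilon_{D^B}\otimes\delta_B)\circ\nabla_{D^B\otimes B}$, and $\upsilon=(\varepsilon_{D^B}\otimes\varepsilon_B)\circ\nabla_{D^B\otimes B}$.
   Context: $\mathcal C$ is a strict braided monoidal category with tensor product $\otimes$, unit object $K$ and braiding $c$, in which every idempotent splits. Algebras have unit $\eta$, product $\mu$; coalgebras counit $\varepsilon$, coproduct $\delta$; $f\wedge g=\mu\circ(f\otimes g)\circ\delta$. Weak bialgebra: algebra and coalgebra $D$ with $\delta_D\circ\mu_D=(\mu_D\otimes\mu_D)\circ(D\otimes c_{D,D}\otimes D)\circ(\delta_D\otimes\delta_D)$; $\varepsilon_D\circ\mu_D\circ(\mu_D\otimes D)=((\varepsilon_D\circ\mu_D)\otimes(\varepsilon_D\circ\mu_D))\circ(D\otimes\delta_D\otimes D)=((\varepsilon_D\circ\mu_D)\otimes(\varepsilon_D\circ\mu_D))\circ(D\otimes(c_{D,D}^{-1}\circ\delta_D)\otimes D)$; $(\delta_D\otimes D)\circ\delta_D\circ\eta_D=(D\otimes\mu_D\otimes D)\circ((\delta_D\circ\eta_D)\otimes(\delta_D\circ\eta_D))=(D\otimes(\mu_D\circ c_{D,D}^{-1})\otimes D)\circ((\delta_D\circ\eta_D)\otimes(\delta_D\circ\eta_D))$. Weak Hopf algebra: additionally an antipode $\lambda_D$ with $id_D\wedge\lambda_D=\Pi_D^L$, $\lambda_D\wedge id_D=\Pi_D^R$, $\lambda_D\wedge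 id_D\wedge\lambda_D=\lambda_D$, where $\Pi_D^L=((\varepsilon_D\circ\mu_D)\otimes D)\circ(D\otimes c_{D,D})\circ((\delta_D\circ\eta_D)\otimes D)$, $\Pi_D^R=(D\otimes(\varepsilon_D\circ\mu_D))\circ(c_{D,D}\otimes D)\circ(D\otimes(\delta_D\circ\eta_D))$. Weak projection $(D,B,f,g)$: $D$ weak bialgebra, $B$ weak Hopf algebra, $f:B\rightarrow D$ algebra and coalgebra morphism, $g:D\rightarrow B$ coalgebra morphism, $g\circ f=id_B$, $g\circ\mu_D\circ(D\otimes f)=\mu_B\circ(g\otimes B)$. Weak crossed product on $C\otimes A$ ($A$ algebra, $C$ object): given $\psi_A^C:A\otimes C\rightarrow C\otimes A$ with $(C\otimes\mu_A)\circ(\psi_A^C\otimes A)\circ(A\otimes\psi_A^C)=\psi_A^C\circ(\mu_A\otimes C)$, $\nabla_{C\otimes A}=(C\otimes\mu_A)\circ((\psi_A^C\circ(\eta_A\otimes C))\otimes A)$ (idempotent, image $C\times A$, injection $i_{C\otimes A}$, projection $p_{C\otimes A}$); $\sigma_A^C:C\otimes C\rightarrow C\otimes A$ with $\nabla_{C\otimes A}\circ\sigma_A^C=\sigma_A^C$; twisted condition $(C\otimes\mu_A)\circ(\sigma_A^C\otimes A)\circ(C\otimes\psi_A^C)\circ(\psi_A^C\otimes C)=(C\otimes\mu_A)\circ(\psi_A^C\otimes A)\circ(A\otimes\sigma_A^C)$; cocycle condition $(C\otimes\mu_A)\circ(\sigma_A^C\otimes A)\circ(C\otimes\sigma_A^C)=(C\otimes\mu_A)\circ(\sigma_A^C\otimes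 A)\circ(C\otimes\psi_A^C)\circ(\sigma_A^C\otimes C)$; product $\mu_{C\otimes A}=(C\otimes\mu_A)\circ(\sigma_A^C\otimes\mu_A)\circ(C\otimes\psi_A^C\otimes A)$. Preunit $\nu:K\rightarrow C\otimes A$, with $\beta_\nu=(C\otimes\mu_A)\circ(\nu\otimes A)$: $(C\otimes\mu_A)\circ(\sigma_A^C\otimes A)\circ(C\otimes\psi_A^C)\circ(\nu\otimes C)=\nabla_{C\otimes A}\circ(C\otimes\eta_A)$, $(C\otimes\mu_A)\circ(\sigma_A^C\otimes A)\circ(C\otimes\nu)=\nabla_{C\otimes A}\circ(C\otimes\eta_A)$, $(C\otimes\mu_A)\circ(\psi_A^C\otimes A)\circ(A\otimes\nu)=\beta_\nu$. Then $C\times A$ is an algebra with product $p_{C\otimes A}\circ\mu_{C\otimes A}\circ(i_{C\otimes A}\otimes i_{C\otimes A})$ and unit $p_{C\otimes A}\circ\nu$. Weak crossed coproduct on $C\otimes A$ ($C$ coalgebra, $A$ object): $\chi_A^C:C\otimes A\rightarrow A\otimes C$ with $(\chi_A^C\otimes C)\circ(C\otimes\chi_A^C)\circ(\delta_C\otimes A)=(A\otimes\delta_C)\circ\chi_A^C$; $\Gamma_{C\otimes A}=(C\otimes A\otimes\varepsilon_C)\circ(C\otimes\chi_A^C)\circ(\delta_C\otimes A)$ (idempotent); $\tau_A^C:C\otimes A\rightarrow A\otimes A$ with $\tau_A^C\circ\Gamma_{C\otimes A}=\tau_A^C$; twisted $(\tau_A^C\otimes C)\circ(C\otimes\chi_A^C)\circ(\delta_C\otimes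 A)=(A\otimes\chi_A^C)\circ(\chi_A^C\otimes A)\circ(C\otimes\tau_A^C)\circ(\delta_C\otimes A)$; cocycle $(\tau_A^C\otimes A)\circ(C\otimes\tau_A^C)\circ(\delta_C\otimes A)=(A\otimes\tau_A^C)\circ(\chi_A^C\otimes A)\circ(C\otimes\tau_A^C)\circ(\delta_C\otimes A)$; coproduct $\delta_{C\otimes A}=(C\otimes\chi_A^C\otimes A)\circ(\delta_C\otimes\tau_A^C)\circ(\delta_C\otimes A)$. Precounit $\upsilon:C\otimes A\rightarrow K$, with $\gamma_\upsilon=(C\otimes\upsilon)\circ(\delta_C\otimes A)$: $(A\otimes\upsilon)\circ(\chi_A^C\otimes A)\circ(C\otimes\tau_A^C)\circ(\delta_C\otimes A)=(\varepsilon_C\otimes A)\circ\Gamma_{C\otimes A}$, $(\upsilon\otimes A)\circ(C\otimes\tau_A^C)\circ(\delta_C\otimes A)=(\varepsilon_C\otimes A)\circ\Gamma_{C\otimes A}$, $(\upsilon\otimes C)\circ(C\otimes\chi_A^C)\circ(\delta_C\otimes A)=\gamma_\upsilon$. Then the image of $\Gamma_{C\otimes A}$ (injection $i$, projection $p$) is a coalgebra with coproduct $(p\otimes p)\circ\delta_{C\otimes A}\circ i$ and counit $\upsilon\circ i$. A weak bialgebra $D$ is a weak crossed biproduct of the coalgebra $C$ with the algebra $A$ (with morphisms $\psi_A^C,\sigma_A^C,\chi_A^C,\tau_A^C$, preunit $\nu$, precounit $\upsilon$) if: $(C\otimes A,\mu_{C\otimes A})$ is a weak crossed product with preunit $\nu$;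 $(C\otimes A,\delta_{C\otimes A})$ is a weak crossed coproduct with precounit $\upsilon$; $\nabla_{C\otimes A}=\Gamma_{C\otimes A}$; there is an isomorphism of algebras and coalgebras $C\times A\rightarrow D$; and $(\varepsilon_C\otimes A)\circ\nu=\eta_A$, $\upsilon\circ(C\otimes\eta_A)=\varepsilon_C$. *)

theory Defs
  imports Main
begin

text \<open>A category is given by a type of objects 'o and a type of (candidate) arrows 'm,
  with a predicate arr singling out the actual arrows, domain/codomain, identities
  and composition (comp g f is g after f).  The monoidal structure is strict:
  tensor products of objects and arrows are strictly associative and unital.\<close>

record ('o, 'm) bcat =
  arr   :: "'m \<Rightarrow> bool"
  dom   :: "'m \<Rightarrow> 'o"
  cod   :: "'m \<Rightarrow> 'o"
  idm   :: "'o \<Rightarrow> 'm"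
  comp  :: "'m \<Rightarrow> 'm \<Rightarrow> 'm"
  tobj  :: "'o \<Rightarrow> 'o \<Rightarrow> 'o"
  tarr  :: "'m \<Rightarrow> 'm \<Rightarrow> 'm"
  unit  :: "'o"
  braid :: "'o \<Rightarrow> 'o \<Rightarrow> 'm"
  ibraid :: "'o \<Rightarrow> 'o \<Rightarrow> 'm"

locale strict_braided_cat =
  fixes C :: "('o, 'm) bcat"
  assumes comp_arr: "\<lbrakk>arr C f; arr C g; dom C g = cod C f\<rbrakk> \<Longrightarrow>
      arr C (comp C g f) \<and> dom C (comp C g f) = dom C f \<and> cod C (comp C g f) = cod C g"
    and comp_assoc: "\<lbrakk>arr C f; arr C g; arr C h; dom C g = cod C f; dom C h = cod C g\<rbrakk> \<Longrightarrow>
      comp C h (comp C g f) = comp C (comp C h g) f"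
    and idm_arr: "arr C (idm C A) \<and> dom C (idm C A) = A \<and> cod C (idm C A) = A"
    and idm_left: "arr C f \<Longrightarrow> comp C (idm C (cod C f)) f = f"
    and idm_right: "arr C f \<Longrightarrow> comp C f (idm C (dom C f)) = f"
    and tarr_arr: "\<lbrakk>arr C f; arr C g\<rbrakk> \<Longrightarrow> arr C (tarr C f g) \<and>
      dom C (tarr C f g) = tobj C (dom C f) (dom C g) \<and> cod C (tarr C f g) = tobj C (cod C f) (cod C g)"
    and tarr_idm: "tarr C (idm C A) (idm C B) = idm C (tobj C A B)"
    and interchange: "\<lbrakk>arr C f; arr C g; arr C f'; arr C g'; dom C g = cod C f; dom C g' = cod C f'\<rbrakk> \<Longrightarrow>
      comp C (tarr C g g') (tarr C f f') = tarr C (comp C g f) (comp C g' f')"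
    and tobj_assoc: "tobj C (tobj C A B) D = tobj C A (tobj C B D)"
    and tarr_assoc: "\<lbrakk>arr C f; arr C g; arr C h\<rbrakk> \<Longrightarrow> tarr C (tarr C f g) h = tarr C f (tarr C g h)"
    and tobj_unit: "tobj C (unit C) A = A" "tobj C A (unit C) = A"
    and tarr_unit: "arr C f \<Longrightarrow> tarr C (idm C (unit C)) f = f"
                   "arr C f \<Longrightarrow> tarr C f (idm C (unit C)) = f"
    and braid_arr: "arr C (braid C A B) \<and> dom C (braid C A B) = tobj C A B \<and> cod C (braid C A B) = tobj C B A"
    and ibraid_arr: "arr C (ibraid C A B) \<and> dom C (ibraid C A B) = tobj C B A \<and> cod C (ibraid C A B) = tobj C A B"
    and braid_inv: "comp C (ibraid C A B) (braid C A B) = idm C (tobj C A B)"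
                   "comp C (braid C A B) (ibraid C A B) = idm C (tobj C B A)"
    and braid_nat: "\<lbrakk>arr C f; arr C g\<rbrakk> \<Longrightarrow>
      comp C (braid C (cod C f) (cod C g)) (tarr C f g) = comp C (tarr C g f) (braid C (dom C f) (dom C g))"
    and hexagon1: "braid C A (tobj C B D) =
      comp C (tarr C (idm C B) (braid C A D)) (tarr C (braid C A B) (idm C D))"
    and hexagon2: "braid C (tobj C A B) D =
      comp C (tarr C (braid C A D) (idm C B)) (tarr C (idm C A) (braid C B D))"
    and idempotents_split: "\<lbrakk>arr C e; dom C e = A; cod C e = A; comp C e e = e\<rbrakk> \<Longrightarrow>
      \<exists>P p i. arr C p \<and> dom C p = A \<and> cod C p = P \<and> arr C i \<and> dom C i = P \<and> cod C i = A
        \<and> comp C i p = e \<and> comp C p i = idm C P"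

context
  fixes C :: "('o, 'm) bcat"
begin

abbreviation cmp (infixr "\<cdot>" 55) where "g \<cdot> f \<equiv> comp C g f"
abbreviation tns (infixr "\<otimes>" 70) where "f \<otimes> g \<equiv> tarr C f g"
abbreviation tob (infixr "\<odot>" 70) where "A \<odot> B \<equiv> tobj C A B"
abbreviation ids where "ids A \<equiv> idm C A"
abbreviation KK where "KK \<equiv> unit C"
abbreviation cc where "cc A B \<equiv> braid C A B"
abbreviation cci where "cci A B \<equiv> ibraid C A B"

definition hom :: "'o \<Rightarrow> 'o \<Rightarrow> 'm set" where
  "hom A B = {f. arr C f \<and> dom C f = A \<and> cod C f = B}"

definition algebra :: "'o \<Rightarrow> 'm \<Rightarrow> 'm \<Rightarrow> bool" where
  "algebra A eta mu \<longleftrightarrow> eta \<in> hom KK A \<and> mu \<in> hom (A \<odot> A) A \<and>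
     mu \<cdot> (eta \<otimes> ids A) = ids A \<and> mu \<cdot> (ids A \<otimes> eta) = ids A \<and>
     mu \<cdot> (mu \<otimes> ids A) = mu \<cdot> (ids A \<otimes> mu)"

definition coalgebra :: "'o \<Rightarrow> 'm \<Rightarrow> 'm \<Rightarrow> bool" where
  "coalgebra A eps delta \<longleftrightarrow> eps \<in> hom A KK \<and> delta \<in> hom A (A \<odot> A) \<and>
     (eps \<otimes> ids A) \<cdot> delta = ids A \<and> (ids A \<otimes> eps) \<cdot> delta = ids A \<and>
     (delta \<otimes> ids A) \<cdot> delta = (ids A \<otimes> delta) \<cdot> delta"

definition conv :: "'m \<Rightarrow> 'm \<Rightarrow> 'm \<Rightarrow> 'm \<Rightarrow> 'm" where
  "conv mu delta f g = mu \<cdot> (f \<otimes> g) \<cdot> delta"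

definition weak_bialgebra :: "'o \<Rightarrow> 'm \<Rightarrow> 'm \<Rightarrow> 'm \<Rightarrow> 'm \<Rightarrow> bool" where
  "weak_bialgebra D eta mu eps delta \<longleftrightarrow>
     algebra D eta mu \<and> coalgebra D eps delta \<and>
     delta \<cdot> mu = (mu \<otimes> mu) \<cdot> (ids D \<otimes> cc D D \<otimes> ids D) \<cdot> (delta \<otimes> delta) \<and>
     eps \<cdot> mu \<cdot> (mu \<otimes> ids D) = ((eps \<cdot> mu) \<otimes> (eps \<cdot> mu)) \<cdot> (ids D \<otimes> delta \<otimes> ids D) \<and>
     eps \<cdot> mu \<cdot> (mu \<otimes> ids D) = ((eps \<cdot> mu) \<otimes> (eps \<cdot> mu)) \<cdot> (ids D \<otimes> (cci D D \<cdot> delta) \<otimes> ids D) \<and>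
     (delta \<otimes> ids D) \<cdot> delta \<cdot> eta = (ids D \<otimes> mu \<otimes> ids D) \<cdot> ((delta \<cdot> eta) \<otimes> (delta \<cdot> eta)) \<and>
     (delta \<otimes> ids D) \<cdot> delta \<cdot> eta = (ids D \<otimes> (mu \<cdot> cci D D) \<otimes> ids D) \<cdot> ((delta \<cdot> eta) \<otimes> (delta \<cdot> eta))"

definition PiL :: "'o \<Rightarrow> 'm \<Rightarrow> 'm \<Rightarrow> 'm \<Rightarrow> 'm \<Rightarrow> 'm" where
  "PiL D eta mu eps delta = ((eps \<cdot> mu) \<otimes> ids D) \<cdot> (ids D \<otimes> cc D D) \<cdot> ((delta \<cdot> eta) \<otimes> ids D)"

definition PiR :: "'o \<Rightarrow> 'm \<Rightarrow> 'm \<Rightarrow> 'm \<Rightarrow> 'm \<Rightarrow> 'm" where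
  "PiR D eta mu eps delta = (ids D \<otimes> (eps \<cdot> mu)) \<cdot> (cc D D \<otimes> ids D) \<cdot> (ids D \<otimes> (delta \<cdot> eta))"

definition weak_hopf_algebra :: "'o \<Rightarrow> 'm \<Rightarrow> 'm \<Rightarrow> 'm \<Rightarrow> 'm \<Rightarrow> 'm \<Rightarrow> bool" where
  "weak_hopf_algebra D eta mu eps delta lam \<longleftrightarrow>
     weak_bialgebra D eta mu eps delta \<and> lam \<in> hom D D \<and>
     conv mu delta (ids D) lam = PiL D eta mu eps delta \<and>
     conv mu delta lam (ids D) = PiR D eta mu eps delta \<and>
     conv mu delta (conv mu delta lam (ids D)) lam = lam"

definition algebra_morphism :: "'o \<Rightarrow> 'm \<Rightarrow> 'm \<Rightarrow> 'o \<Rightarrow> 'm \<Rightarrow> 'm \<Rightarrow> 'm \<Rightarrow> bool" where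
  "algebra_morphism A etaA muA B etaB muB h \<longleftrightarrow>
     h \<in> hom A B \<and> h \<cdot> etaA = etaB \<and> h \<cdot> muA = muB \<cdot> (h \<otimes> h)"

definition coalgebra_morphism :: "'o \<Rightarrow> 'm \<Rightarrow> 'm \<Rightarrow> 'o \<Rightarrow> 'm \<Rightarrow> 'm \<Rightarrow> 'm \<Rightarrow> bool" where
  "coalgebra_morphism A epsA deltaA B epsB deltaB h \<longleftrightarrow>
     h \<in> hom A B \<and> epsB \<cdot> h = epsA \<and> deltaB \<cdot> h = (h \<otimes> h) \<cdot> deltaA"

definition weak_projection ::
  "'o \<Rightarrow> 'm \<Rightarrow> 'm \<Rightarrow> 'm \<Rightarrow> 'm \<Rightarrow> 'o \<Rightarrow> 'm \<Rightarrow> 'm \<Rightarrow> 'm \<Rightarrow> 'm \<Rightarrow> 'm \<Rightarrow> 'm \<Rightarrow> 'm \<Rightarrow> bool" where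
  "weak_projection D etaD muD epsD deltaD B etaB muB epsB deltaB lamB f g \<longleftrightarrow>
     weak_bialgebra D etaD muD epsD deltaD \<and>
     weak_hopf_algebra B etaB muB epsB deltaB lamB \<and>
     algebra_morphism B etaB muB D etaD muD f \<and>
     coalgebra_morphism B epsB deltaB D epsD deltaD f \<and>
     coalgebra_morphism D epsD deltaD B epsB deltaB g \<and>
     g \<cdot> f = ids B \<and>
     g \<cdot> muD \<cdot> (ids D \<otimes> f) = muB \<cdot> (g \<otimes> ids B)"

definition nabla :: "'o \<Rightarrow> 'o \<Rightarrow> 'm \<Rightarrow> 'm \<Rightarrow> 'm \<Rightarrow> 'm" where
  "nabla Co A etaA muA psi = (ids Co \<otimes> muA) \<cdot> ((psi \<cdot> (etaA \<otimes> ids Co)) \<otimes> ids A)"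

definition mu_cp :: "'o \<Rightarrow> 'o \<Rightarrow> 'm \<Rightarrow> 'm \<Rightarrow> 'm \<Rightarrow> 'm" where
  "mu_cp Co A muA psi sigma = (ids Co \<otimes> muA) \<cdot> (sigma \<otimes> muA) \<cdot> (ids Co \<otimes> psi \<otimes> ids A)"

definition beta_nu :: "'o \<Rightarrow> 'o \<Rightarrow> 'm \<Rightarrow> 'm \<Rightarrow> 'm" where
  "beta_nu Co A muA nu = (ids Co \<otimes> muA) \<cdot> (nu \<otimes> ids A)"

definition weak_crossed_product_preunit ::
  "'o \<Rightarrow> 'o \<Rightarrow> 'm \<Rightarrow> 'm \<Rightarrow> 'm \<Rightarrow> 'm \<Rightarrow> 'm \<Rightarrow> bool" where
  "weak_crossed_product_preunit Co A etaA muA psi sigma nu \<longleftrightarrow>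
     algebra A etaA muA \<and>
     psi \<in> hom (A \<odot> Co) (Co \<odot> A) \<and> sigma \<in> hom (Co \<odot> Co) (Co \<odot> A) \<and> nu \<in> hom KK (Co \<odot> A) \<and>
     (ids Co \<otimes> muA) \<cdot> (psi \<otimes> ids A) \<cdot> (ids A \<otimes> psi) = psi \<cdot> (muA \<otimes> ids Co) \<and>
     nabla Co A etaA muA psi \<cdot> sigma = sigma \<and>
     (ids Co \<otimes> muA) \<cdot> (sigma \<otimes> ids A) \<cdot> (ids Co \<otimes> psi) \<cdot> (psi \<otimes> ids Co)
       = (ids Co \<otimes> muA) \<cdot> (psi \<otimes> ids A) \<cdot> (ids A \<otimes> sigma) \<and>
     (ids Co \<otimes> muA) \<cdot> (sigma \<otimes> ids A) \<cdot> (ids Co \<otimes> sigma)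
       = (ids Co \<otimes> muA) \<cdot> (sigma \<otimes> ids A) \<cdot> (ids Co \<otimes> psi) \<cdot> (sigma \<otimes> ids Co) \<and>
     (ids Co \<otimes> muA) \<cdot> (sigma \<otimes> ids A) \<cdot> (ids Co \<otimes> psi) \<cdot> (nu \<otimes> ids Co)
       = nabla Co A etaA muA psi \<cdot> (ids Co \<otimes> etaA) \<and>
     (ids Co \<otimes> muA) \<cdot> (sigma \<otimes> ids A) \<cdot> (ids Co \<otimes> nu)
       = nabla Co A etaA muA psi \<cdot> (ids Co \<otimes> etaA) \<and>
     (ids Co \<otimes> muA) \<cdot> (psi \<otimes> ids A) \<cdot> (ids A \<otimes> nu) = beta_nu Co A muA nu"

definition Gamma :: "'o \<Rightarrow> 'o \<Rightarrow> 'm \<Rightarrow> 'm \<Rightarrow> 'm \<Rightarrow> 'm" where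
  "Gamma Co A epsC deltaC chi = (ids Co \<otimes> ids A \<otimes> epsC) \<cdot> (ids Co \<otimes> chi) \<cdot> (deltaC \<otimes> ids A)"

definition delta_cp :: "'o \<Rightarrow> 'o \<Rightarrow> 'm \<Rightarrow> 'm \<Rightarrow> 'm \<Rightarrow> 'm" where
  "delta_cp Co A deltaC chi tau = (ids Co \<otimes> chi \<otimes> ids A) \<cdot> (deltaC \<otimes> tau) \<cdot> (deltaC \<otimes> ids A)"

definition gamma_upsilon :: "'o \<Rightarrow> 'o \<Rightarrow> 'm \<Rightarrow> 'm \<Rightarrow> 'm" where
  "gamma_upsilon Co A deltaC ups = (ids Co \<otimes> ups) \<cdot> (deltaC \<otimes> ids A)"

definition weak_crossed_coproduct_precounit ::
  "'o \<Rightarrow> 'o \<Rightarrow> 'm \<Rightarrow> 'm \<Rightarrow> 'm \<Rightarrow> 'm \<Rightarrow> 'm \<Rightarrow> bool" where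
  "weak_crossed_coproduct_precounit Co A epsC deltaC chi tau ups \<longleftrightarrow>
     coalgebra Co epsC deltaC \<and>
     chi \<in> hom (Co \<odot> A) (A \<odot> Co) \<and> tau \<in> hom (Co \<odot> A) (A \<odot> A) \<and> ups \<in> hom (Co \<odot> A) KK \<and>
     (chi \<otimes> ids Co) \<cdot> (ids Co \<otimes> chi) \<cdot> (deltaC \<otimes> ids A) = (ids A \<otimes> deltaC) \<cdot> chi \<and>
     tau \<cdot> Gamma Co A epsC deltaC chi = tau \<and>
     (tau \<otimes> ids Co) \<cdot> (ids Co \<otimes> chi) \<cdot> (deltaC \<otimes> ids A)
       = (ids A \<otimes> chi) \<cdot> (chi \<otimes> ids A) \<cdot> (ids Co \<otimes> tau) \<cdot> (deltaC \<otimes> ids A) \<and>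
     (tau \<otimes> ids A) \<cdot> (ids Co \<otimes> tau) \<cdot> (deltaC \<otimes> ids A)
       = (ids A \<otimes> tau) \<cdot> (chi \<otimes> ids A) \<cdot> (ids Co \<otimes> tau) \<cdot> (deltaC \<otimes> ids A) \<and>
     (ids A \<otimes> ups) \<cdot> (chi \<otimes> ids A) \<cdot> (ids Co \<otimes> tau) \<cdot> (deltaC \<otimes> ids A)
       = (epsC \<otimes> ids A) \<cdot> Gamma Co A epsC deltaC chi \<and>
     (ups \<otimes> ids A) \<cdot> (ids Co \<otimes> tau) \<cdot> (deltaC \<otimes> ids A)
       = (epsC \<otimes> ids A) \<cdot> Gamma Co A epsC deltaC chi \<and>
     (ups \<otimes> ids Co) \<cdot> (ids Co \<otimes> chi) \<cdot> (deltaC \<otimes> ids A) = gamma_upsilon Co A deltaC ups"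

text \<open>D is a weak crossed biproduct of the coalgebra Co with the algebra A.
  The object Co \<times> A is the image of the idempotent nabla (= Gamma), given by a splitting
  (P, p, i); the algebra/coalgebra structure on it is the one described in the paper,
  and there must be an isomorphism of algebras and coalgebras from it onto D.\<close>
definition weak_crossed_biproduct ::
  "'o \<Rightarrow> 'm \<Rightarrow> 'm \<Rightarrow> 'm \<Rightarrow> 'm \<Rightarrow> 'o \<Rightarrow> 'm \<Rightarrow> 'm \<Rightarrow> 'o \<Rightarrow> 'm \<Rightarrow> 'm \<Rightarrow>
   'm \<Rightarrow> 'm \<Rightarrow> 'm \<Rightarrow> 'm \<Rightarrow> 'm \<Rightarrow> 'm \<Rightarrow> bool" where
  "weak_crossed_biproduct D etaD muD epsD deltaD Co epsC deltaC A etaA muA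
       psi sigma chi tau nu ups \<longleftrightarrow>
     weak_bialgebra D etaD muD epsD deltaD \<and>
     coalgebra Co epsC deltaC \<and> algebra A etaA muA \<and>
     weak_crossed_product_preunit Co A etaA muA psi sigma nu \<and>
     weak_crossed_coproduct_precounit Co A epsC deltaC chi tau ups \<and>
     nabla Co A etaA muA psi = Gamma Co A epsC deltaC chi \<and>
     (\<exists>P p i w w'.
        p \<in> hom (Co \<odot> A) P \<and> i \<in> hom P (Co \<odot> A) \<and>
        i \<cdot> p = nabla Co A etaA muA psi \<and> p \<cdot> i = ids P \<and>
        w \<in> hom P D \<and> w' \<in> hom D P \<and> w' \<cdot> w = ids P \<and> w \<cdot> w' = ids D \<and>
        algebra_morphism P (p \<cdot> nu) (p \<cdot> mu_cp Co A muA psi sigma \<cdot> (i \<otimes> i)) D etaD muD w \<and>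
        coalgebra_morphism P (ups \<cdot> i) ((p \<otimes> p) \<cdot> delta_cp Co A deltaC chi tau \<cdot> i) D epsD deltaD w) \<and>
     (epsC \<otimes> ids A) \<cdot> nu = etaA \<and>
     ups \<cdot> (ids Co \<otimes> etaA) = epsC"

end

end

theory Submission
  imports Defs
begin

text \<open>
  Put \<open>\<omega> = \<mu>\<^sub>D \<circ> (i \<otimes> f)\<close> and \<open>\<omega>' = (p \<otimes> g) \<circ> \<delta>\<^sub>D\<close>. Then \<open>\<omega> \<circ> \<omega>' = id\<^sub>D\<close>, because
  \<open>f \<circ> \<Pi>\<^sup>R\<^sub>B \<circ> g = \<Pi>\<^sup>R\<^sub>D\<close>, and the identity
  \<open>(p \<otimes> D) \<circ> \<delta>\<^sub>D \<circ> \<mu>\<^sub>D \<circ> (D \<otimes> f) = (D\<^sup>B \<otimes> \<mu>\<^sub>D) \<circ> (((p \<otimes> D) \<circ> \<delta>\<^sub>D) \<otimes> f)\<close> makes \<open>\<omega>'\<close> right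
  \<open>B\<close>-linear and \<open>\<omega>\<close> left \<open>D\<^sup>B\<close>-colinear. From these facts alone it follows that
  \<open>\<nabla> = \<Gamma> = \<omega>' \<circ> \<omega>\<close>, that the crossed product and coproduct are the transports of \<open>\<mu>\<^sub>D\<close> and
  \<open>\<delta>\<^sub>D\<close> along \<open>\<omega>\<close> and \<open>\<omega>'\<close>, and that all axioms hold.

  The displayed identity rests on \<open>p(d f(b)) = p(d f(\<Pi>'(b)))\<close> for \<open>\<Pi>'(b) = 1\<^sub>1 \<epsilon>(1\<^sub>2 b)\<close>,
  which satisfies \<open>\<Pi>'(b\<^sub>1) \<otimes> b\<^sub>2 = 1\<^sub>1 \<otimes> 1\<^sub>2 b\<close>. That in turn is a consequence of
  \<open>b\<^sub>1 \<lambda>(x b\<^sub>2) = \<lambda>(x\<^sub>1) \<Pi>\<^sup>L(x\<^sub>2 b)\<close>, whose right-hand side only depends on \<open>\<Pi>'(b)\<close>; no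
  antimultiplicativity of the antipode is needed.
\<close>

section \<open>Arrows typed by words of objects\<close>

text \<open>Recording source and target as lists makes the factorisation of a tensor product
  computable, so the simplifier can decide equality up to the interchange law.\<close>

datatype ('o, 'm) warr = Warr (src: "'o list") (mor: 'm) (tgt: "'o list")

context strict_braided_cat
begin

definition word :: "'o list \<Rightarrow> 'o" where
  "word u = foldr (tobj C) u (unit C)"

definition whom :: "'o list \<Rightarrow> 'o list \<Rightarrow> ('o, 'm) warr set" where
  "whom u v = {a. src a = u \<and> tgt a = v \<and> mor a \<in> hom C (word u) (word v)}"

abbreviation valid :: "('o, 'm) warr \<Rightarrow> bool" where
  "valid a \<equiv> a \<in> whom (src a) (tgt a)"

definition wcomp :: "('o, 'm) warr \<Rightarrow> ('o, 'm) warr \<Rightarrow> ('o, 'm) warr" (infixr "\<bullet>" 55) where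
  "b \<bullet> a = Warr (src a) (comp C (mor b) (mor a)) (tgt b)"

definition wtens :: "('o, 'm) warr \<Rightarrow> ('o, 'm) warr \<Rightarrow> ('o, 'm) warr" (infixr "\<otimes>" 70) where
  "a \<otimes> b = Warr (src a @ src b) (tarr C (mor a) (mor b)) (tgt a @ tgt b)"

definition wid :: "'o list \<Rightarrow> ('o, 'm) warr" where
  "wid u = Warr u (idm C (word u)) u"

definition wbraid :: "'o list \<Rightarrow> 'o list \<Rightarrow> ('o, 'm) warr" where
  "wbraid u v = Warr (u @ v) (braid C (word u) (word v)) (v @ u)"

definition wibraid :: "'o list \<Rightarrow> 'o list \<Rightarrow> ('o, 'm) warr" where
  "wibraid u v = Warr (v @ u) (ibraid C (word u) (word v)) (u @ v)"

text \<open>One generator acting between identity strands. Composites and tensor products of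
  generators unfold into chains of such arrows, and these chains are what the rewrite rules below
  normalise.\<close>

definition whisker :: "'o list \<Rightarrow> ('o, 'm) warr \<Rightarrow> 'o list \<Rightarrow> ('o, 'm) warr" where
  "whisker u a v = wid u \<otimes> a \<otimes> wid v"

section \<open>Strict monoidal and braided laws for arrows typed by words\<close>

lemma word_simps [simp]:
  "word [] = unit C" "word (A # u) = tobj C A (word u)"
  "word (u @ v) = tobj C (word u) (word v)"
  by (simp add: word_def, simp add: word_def, induction u)
     (simp_all add: word_def tobj_unit tobj_assoc)

lemma src_tgt_simps [simp]:
  "src (b \<bullet> a) = src a" "tgt (b \<bullet> a) = tgt b"
  "src (a \<otimes> b) = src a @ src b" "tgt (a \<otimes> b) = tgt a @ tgt b"
  "src (wid u) = u" "tgt (wid u) = u"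
  "src (wbraid u v) = u @ v" "tgt (wbraid u v) = v @ u"
  "src (wibraid u v) = v @ u" "tgt (wibraid u v) = u @ v"
  "src (whisker u a v) = u @ src a @ v" "tgt (whisker u a v) = u @ tgt a @ v"
  by (simp_all add: wcomp_def wtens_def wid_def wbraid_def wibraid_def whisker_def)

lemma mor_simps [simp]:
  "mor (b \<bullet> a) = comp C (mor b) (mor a)"
  "mor (a \<otimes> b) = tarr C (mor a) (mor b)"
  "mor (wid u) = idm C (word u)"
  "mor (wbraid u v) = braid C (word u) (word v)"
  "mor (wibraid u v) = ibraid C (word u) (word v)"
  by (simp_all add: wcomp_def wtens_def wid_def wbraid_def wibraid_def)

lemma whomD:
  assumes "a \<in> whom u v"
  shows "valid a" "src a = u" "tgt a = v" "mor a \<in> hom C (word u) (word v)"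
  using assms by (simp_all add: whom_def)

lemma warr_eqI: "src a = src b \<Longrightarrow> tgt a = tgt b \<Longrightarrow> mor a = mor b \<Longrightarrow> a = b"
  by (cases a; cases b) simp

text \<open>The words in the conclusion are variables tied by equations, so the rule matches any
  goal of this kind and the typing is settled by computing with lists.\<close>

lemma valid_comp [simp]:
  "valid a \<Longrightarrow> valid b \<Longrightarrow> src b = tgt a \<Longrightarrow> src a = u \<Longrightarrow> tgt b = v \<Longrightarrow> b \<bullet> a \<in> whom u v"
  using comp_arr[of "mor a" "mor b"] by (simp add: whom_def hom_def)

lemma valid_tens [simp]:
  "valid a \<Longrightarrow> valid b \<Longrightarrow> src a @ src b = u \<Longrightarrow> tgt a @ tgt b = v \<Longrightarrow> a \<otimes> b \<in> whom u v"
  using tarr_arr[of "mor a" "mor b"] by (auto simp: whom_def hom_def)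

lemma valid_struct [simp]:
  "wid u \<in> whom u u"
  "u @ v = x \<Longrightarrow> v @ u = y \<Longrightarrow> wbraid u v \<in> whom x y"
  "v @ u = x \<Longrightarrow> u @ v = y \<Longrightarrow> wibraid u v \<in> whom x y"
  by (auto simp: whom_def hom_def idm_arr braid_arr ibraid_arr)

lemma valid_whisker [simp]:
  "valid a \<Longrightarrow> u @ src a @ v = x \<Longrightarrow> u @ tgt a @ v = y \<Longrightarrow> whisker u a v \<in> whom x y"
  by (simp add: whisker_def)

lemma wcomp_assoc [simp]:
  "valid a \<Longrightarrow> valid b \<Longrightarrow> valid c \<Longrightarrow> src b = tgt a \<Longrightarrow> src c = tgt b \<Longrightarrow> (c \<bullet> b) \<bullet> a = c \<bullet> (b \<bullet> a)"
  by (rule warr_eqI) (simp_all add: whom_def hom_def comp_assoc)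

lemma wtens_assoc [simp]:
  "valid a \<Longrightarrow> valid b \<Longrightarrow> valid c \<Longrightarrow> (a \<otimes> b) \<otimes> c = a \<otimes> (b \<otimes> c)"
  by (rule warr_eqI) (simp_all add: whom_def hom_def tarr_assoc)

lemma wid_comp [simp]:
  "valid a \<Longrightarrow> tgt a = u \<Longrightarrow> wid u \<bullet> a = a"
  "valid a \<Longrightarrow> src a = u \<Longrightarrow> a \<bullet> wid u = a"
  using idm_left[of "mor a"] idm_right[of "mor a"]
  by (auto intro!: warr_eqI simp: whom_def hom_def)

lemma wid_tens [simp]:
  "wid u \<otimes> wid v = wid (u @ v)"
  "valid a \<Longrightarrow> wid [] \<otimes> a = a"
  "valid a \<Longrightarrow> a \<otimes> wid [] = a"
  by (rule warr_eqI, simp_all add: whom_def hom_def tarr_idm tarr_unit)+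

lemma winterchange:
  "valid a \<Longrightarrow> valid b \<Longrightarrow> valid a' \<Longrightarrow> valid b' \<Longrightarrow> src b = tgt a \<Longrightarrow> src b' = tgt a' \<Longrightarrow>
   (b \<otimes> b') \<bullet> (a \<otimes> a') = (b \<bullet> a) \<otimes> (b' \<bullet> a')"
  by (rule warr_eqI) (simp_all add: whom_def hom_def interchange)

lemma wbraid_nat:
  "valid a \<Longrightarrow> valid b \<Longrightarrow> src a = u \<Longrightarrow> src b = v \<Longrightarrow> tgt a = u' \<Longrightarrow> tgt b = v' \<Longrightarrow>
    wbraid u' v' \<bullet> (a \<otimes> b) = (b \<otimes> a) \<bullet> wbraid u v"
  by (rule warr_eqI) (use braid_nat[of "mor a" "mor b"] in \<open>auto simp: whom_def hom_def\<close>)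

lemma wbraid_inv:
  "wibraid u v \<bullet> wbraid u v = wid (u @ v)" "wbraid u v \<bullet> wibraid u v = wid (v @ u)"
  by (rule warr_eqI; simp add: braid_inv)+

lemma wbraid_append:
  "wbraid u (v @ w) = (wid v \<otimes> wbraid u w) \<bullet> (wbraid u v \<otimes> wid w)"
  "wbraid (u @ v) w = (wbraid u w \<otimes> wid v) \<bullet> (wid u \<otimes> wbraid v w)"
  by (rule warr_eqI; simp add: hexagon1 hexagon2)+

section \<open>Whiskered generators and the interchange law\<close>

lemma whisker_id [simp]: "whisker u (wid w) v = wid (u @ w @ v)"
  by (simp add: whisker_def)

lemma whisker_whisker [simp]:
  "valid a \<Longrightarrow> whisker u (whisker u' a v') v = whisker (u @ u') a (v' @ v)"
  unfolding whisker_def by (simp flip: wid_tens(1))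

lemma whisker_comp [simp]:
  "valid a \<Longrightarrow> valid b \<Longrightarrow> src b = tgt a \<Longrightarrow> whisker u (b \<bullet> a) v = whisker u b v \<bullet> whisker u a v"
  by (simp add: whisker_def winterchange)

lemma tens_whisker:
  "valid a \<Longrightarrow> valid b \<Longrightarrow> a \<otimes> b = whisker [] a (tgt b) \<bullet> whisker (src a) b []"
  by (simp add: whisker_def winterchange)

lemma whisker_tens [simp]:
  "valid a \<Longrightarrow> valid b \<Longrightarrow> whisker u (a \<otimes> b) v = whisker u a (tgt b @ v) \<bullet> whisker (u @ src a) b v"
  by (simp add: tens_whisker)

text \<open>The word \<open>z\<close> fills the gap between the two generators. Without the outer
  context \<open>u\<close>, \<open>v\<close>, both sides are
  \<open>a \<otimes> wid z \<otimes> b\<close>.\<close>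

lemma whisker_exchange_aux:
  assumes "valid a" "valid b"
  shows "whisker u a (z @ tgt b @ v) \<bullet> whisker (u @ src a @ z) b v
       = whisker (u @ tgt a @ z) b v \<bullet> whisker u a (z @ src b @ v)"
proof -
  have "whisker [] a (z @ tgt b) \<bullet> whisker (src a @ z) b [] = a \<otimes> (wid z \<otimes> b)"
    using assms by (simp add: tens_whisker)
  also have "\<dots> = whisker (tgt a @ z) b [] \<bullet> whisker [] a (z @ src b)"
    using assms by (simp add: whisker_def winterchange flip: wid_tens(1))
  finally have "whisker u (whisker [] a (z @ tgt b) \<bullet> whisker (src a @ z) b []) v
     = whisker u (whisker (tgt a @ z) b [] \<bullet> whisker [] a (z @ src b)) v" by simp
  then show ?thesis using assms by simp
qed

text \<open>The rewrite rule moves generators on the left below those on the right; it normalises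
  diagrams up to the interchange law.\<close>

lemma whisker_exchange [simp]:
  assumes "valid a" "valid b" "length u + length (src a) \<le> length u'"
    "u @ src a @ v = u' @ tgt b @ v'"
  shows "whisker u a v \<bullet> whisker u' b v'
       = whisker (u @ tgt a @ drop (length u + length (src a)) u') b v'
         \<bullet> whisker u a (drop (length u + length (src a)) u' @ src b @ v')"
proof -
  define z where "z = drop (length u + length (src a)) u'"
  \<comment> \<open>The length condition puts \<open>b\<close> entirely to the right of
    \<open>a\<close>, so \<open>u @ src a\<close> is a prefix of \<open>u'\<close> and
    \<open>z\<close> is the gap.\<close>
  have "take (length u + length (src a)) u' = u @ src a"
    using assms(3) arg_cong[OF assms(4), of "take (length u + length (src a))"] by simp
  then have u': "u' = u @ src a @ z"
    by (metis append_assoc append_take_drop_id z_def)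
  then have v: "v = z @ tgt b @ v'" using assms(4) by simp
  show ?thesis
    unfolding z_def[symmetric] using whisker_exchange_aux[OF assms(1,2), of u z v']
    by (simp only: u' v)
qed

text \<open>Composites are kept right-nested by \<open>wcomp_assoc\<close>, so inside a longer chain
  the pair to be swapped comes with a rest \<open>r\<close>; \<open>whisker_exchange\<close> alone
  only sees the end of a chain.\<close>

lemma whisker_exchange_comp [simp]:
  assumes "valid a" "valid b" "length u + length (src a) \<le> length u'"
    "u @ src a @ v = u' @ tgt b @ v'" "valid r" "tgt r = u' @ src b @ v'"
  shows "whisker u a v \<bullet> whisker u' b v' \<bullet> r
       = whisker (u @ tgt a @ drop (length u + length (src a)) u') b v'
         \<bullet> whisker u a (drop (length u + length (src a)) u' @ src b @ v') \<bullet> r"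
proof -
  have "whisker u a v \<bullet> whisker u' b v' \<bullet> r = (whisker u a v \<bullet> whisker u' b v') \<bullet> r"
    by (rule wcomp_assoc[symmetric]) (use assms in simp_all)
  also have "\<dots> = (whisker (u @ tgt a @ drop (length u + length (src a)) u') b v'
         \<bullet> whisker u a (drop (length u + length (src a)) u' @ src b @ v')) \<bullet> r"
    by (subst whisker_exchange[OF assms(1-4)]) (rule refl)
  also have "\<dots> = whisker (u @ tgt a @ drop (length u + length (src a)) u') b v'
         \<bullet> whisker u a (drop (length u + length (src a)) u' @ src b @ v') \<bullet> r"
  proof (rule wcomp_assoc)
    have "take (length u + length (src a)) u' = u @ src a"
      using assms(3) arg_cong[OF assms(4), of "take (length u + length (src a))"] by simp
    then have "u' = u @ src a @ drop (length u + length (src a)) u'"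
      by (metis append_assoc append_take_drop_id)
    then show "src (whisker u a (drop (length u + length (src a)) u' @ src b @ v')) = tgt r"
      using assms(6) by simp
  qed (use assms in simp_all)
  finally show ?thesis .
qed

text \<open>Whiskering by empty words changes nothing, but it gives \<open>whisker_comp\<close> and
  \<open>whisker_tens\<close> a place to start, and both sides then become chains of
  generators.\<close>

lemma diagram_eqI:
  assumes "whisker [] a [] = whisker [] b []" "valid a" "valid b"
  shows "a = b"
  using assms by (simp add: whisker_def)

text \<open>An invertible idempotent is an identity. With a hexagon for empty words this shows that
  braiding with the unit object is trivial.\<close>

lemma wbraid_invD:
  assumes "wbraid u v \<bullet> wbraid u v = wbraid u v" "u @ v = v @ u"
  shows "wbraid u v = wid (u @ v)"
  using arg_cong[OF assms(1), of "\<lambda>a. wibraid u v \<bullet> a"] assms(2)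
  by (simp add: wbraid_inv flip: wcomp_assoc)

lemma wbraid_Nil [simp]: "wbraid u [] = wid u" "wbraid [] u = wid u"
  using wbraid_invD[of u "[]"] wbraid_append(1)[of u "[]" "[]"]
    wbraid_invD[of "[]" u] wbraid_append(2)[of "[]" "[]" u] by simp_all

text \<open>As \<open>k\<close> ends in the unit object, naturality gives \<open>k \<otimes> wid w =
  (wid w \<otimes> k) \<bullet> wbraid (u @ v) w\<close>; the hexagon splits this braiding, and its
  factor \<open>wbraid v w\<close> cancels the inverse. This trades the inverse braiding in the
  counit axiom for an ordinary one.\<close>

lemma cap_wbraid:
  assumes "k \<in> whom (u @ v) []"
  shows "(k \<otimes> wid w) \<bullet> (wid u \<otimes> wibraid v w) = (wid w \<otimes> k) \<bullet> (wbraid u w \<otimes> wid v)"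
proof -
  note [simp] = assms whomD[OF assms]
  have "(k \<otimes> wid w) \<bullet> (wid u \<otimes> wibraid v w)
      = ((wid w \<otimes> k) \<bullet> wbraid (u @ v) w) \<bullet> (wid u \<otimes> wibraid v w)"
    using wbraid_nat[of k "wid w" "u @ v" w "[]" w] by simp
  also have "\<dots> = ((wid w \<otimes> k) \<bullet> (wbraid u w \<otimes> wid v)) \<bullet> (wid u \<otimes> (wbraid v w \<bullet> wibraid v w))"
    unfolding wbraid_append by (rule diagram_eqI) simp_all
  also have "\<dots> = (wid w \<otimes> k) \<bullet> (wbraid u w \<otimes> wid v)"
    unfolding wbraid_inv by (rule diagram_eqI) simp_all
  finally show ?thesis .
qed

end

section \<open>Weak bialgebras and weak Hopf algebras\<close>

locale weak_bialgebra_words = strict_braided_cat C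
  for C :: "('o, 'm) bcat" +
  fixes X :: 'o and \<eta> \<mu> \<epsilon> \<delta> :: "('o, 'm) warr"
  assumes \<eta>_hom: "\<eta> \<in> whom [] [X]" and \<mu>_hom: "\<mu> \<in> whom [X, X] [X]"
    and \<epsilon>_hom: "\<epsilon> \<in> whom [X] []" and \<delta>_hom: "\<delta> \<in> whom [X] [X, X]"
    and unit_left: "\<mu> \<bullet> (\<eta> \<otimes> wid [X]) = wid [X]"
    and unit_right: "\<mu> \<bullet> (wid [X] \<otimes> \<eta>) = wid [X]"
    and assoc: "\<mu> \<bullet> (\<mu> \<otimes> wid [X]) = \<mu> \<bullet> (wid [X] \<otimes> \<mu>)"
    and counit_left: "(\<epsilon> \<otimes> wid [X]) \<bullet> \<delta> = wid [X]"
    and counit_right: "(wid [X] \<otimes> \<epsilon>) \<bullet> \<delta> = wid [X]"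
    and coassoc: "(\<delta> \<otimes> wid [X]) \<bullet> \<delta> = (wid [X] \<otimes> \<delta>) \<bullet> \<delta>"
    and \<delta>_\<mu>: "\<delta> \<bullet> \<mu> = (\<mu> \<otimes> \<mu>) \<bullet> (wid [X] \<otimes> wbraid [X] [X] \<otimes> wid [X]) \<bullet> (\<delta> \<otimes> \<delta>)"
    and \<epsilon>_\<mu>_\<delta>: "\<epsilon> \<bullet> \<mu> \<bullet> (\<mu> \<otimes> wid [X])
        = ((\<epsilon> \<bullet> \<mu>) \<otimes> (\<epsilon> \<bullet> \<mu>)) \<bullet> (wid [X] \<otimes> \<delta> \<otimes> wid [X])"
    and \<epsilon>_\<mu>_\<delta>op: "\<epsilon> \<bullet> \<mu> \<bullet> (\<mu> \<otimes> wid [X])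
        = ((\<epsilon> \<bullet> \<mu>) \<otimes> (\<epsilon> \<bullet> \<mu>)) \<bullet> (wid [X] \<otimes> (wibraid [X] [X] \<bullet> \<delta>) \<otimes> wid [X])"
    and \<delta>_\<delta>_\<eta>: "(\<delta> \<otimes> wid [X]) \<bullet> \<delta> \<bullet> \<eta>
        = (wid [X] \<otimes> \<mu> \<otimes> wid [X]) \<bullet> ((\<delta> \<bullet> \<eta>) \<otimes> (\<delta> \<bullet> \<eta>))"
begin

lemmas hom_simps [simp] = whomD[OF \<eta>_hom] whomD[OF \<mu>_hom] whomD[OF \<epsilon>_hom] whomD[OF \<delta>_hom]
  \<eta>_hom \<mu>_hom \<epsilon>_hom \<delta>_hom

abbreviation one ("\<one>") where "\<one> \<equiv> wid [X]"
abbreviation br ("\<c>") where "\<c> \<equiv> wbraid [X] [X]"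

definition \<kappa> where "\<kappa> = \<epsilon> \<bullet> \<mu>"

lemma \<kappa>_hom: "\<kappa> \<in> whom [X, X] []"
  by (simp add: \<kappa>_def)

lemmas \<kappa>_hom_simps [simp] = \<kappa>_hom whomD[OF \<kappa>_hom]

definition PiL_w where "PiL_w = (\<kappa> \<otimes> \<one>) \<bullet> (\<one> \<otimes> \<c>) \<bullet> ((\<delta> \<bullet> \<eta>) \<otimes> \<one>)"
definition PiR_w where "PiR_w = (\<one> \<otimes> \<kappa>) \<bullet> (\<c> \<otimes> \<one>) \<bullet> (\<one> \<otimes> (\<delta> \<bullet> \<eta>))"
text \<open>In Sweedler notation \<open>1_1 \<epsilon>(1_2 b)\<close>, the map written \<Pi>' in the
  overview.\<close>

definition barPiL where "barPiL = (\<one> \<otimes> \<kappa>) \<bullet> ((\<delta> \<bullet> \<eta>) \<otimes> \<one>)"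

lemma Pi_hom: "PiL_w \<in> whom [X] [X]" "PiR_w \<in> whom [X] [X]" "barPiL \<in> whom [X] [X]"
  by (simp_all add: PiL_w_def PiR_w_def barPiL_def)

lemmas Pi_hom_simps [simp] = Pi_hom whomD[OF Pi_hom(1)] whomD[OF Pi_hom(2)] whomD[OF Pi_hom(3)]

lemma \<kappa>_assoc: "\<kappa> \<bullet> (\<mu> \<otimes> \<one>) = \<kappa> \<bullet> (\<one> \<otimes> \<mu>)"
  by (simp add: \<kappa>_def assoc)

lemma \<kappa>_\<mu>: "\<kappa> \<bullet> (\<mu> \<otimes> \<one>) = (\<kappa> \<otimes> \<kappa>) \<bullet> (\<one> \<otimes> \<delta> \<otimes> \<one>)"
  using \<epsilon>_\<mu>_\<delta> by (simp add: \<kappa>_def)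

lemma counit_left_\<mu>: "(\<kappa> \<otimes> \<mu>) \<bullet> (\<one> \<otimes> \<c> \<otimes> \<one>) \<bullet> (\<delta> \<otimes> \<delta>) = \<mu>"
proof -
  have "(\<kappa> \<otimes> \<mu>) \<bullet> (\<one> \<otimes> \<c> \<otimes> \<one>) \<bullet> (\<delta> \<otimes> \<delta>) = (\<epsilon> \<otimes> \<one>) \<bullet> (\<delta> \<bullet> \<mu>)"
    unfolding \<delta>_\<mu> \<kappa>_def by (rule diagram_eqI) simp_all
  also have "\<dots> = ((\<epsilon> \<otimes> \<one>) \<bullet> \<delta>) \<bullet> \<mu>" by simp
  finally show ?thesis by (simp add: counit_left)
qed

lemma counit_right_\<mu>: "(\<mu> \<otimes> \<kappa>) \<bullet> (\<one> \<otimes> \<c> \<otimes> \<one>) \<bullet> (\<delta> \<otimes> \<delta>) = \<mu>"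
proof -
  have "(\<mu> \<otimes> \<kappa>) \<bullet> (\<one> \<otimes> \<c> \<otimes> \<one>) \<bullet> (\<delta> \<otimes> \<delta>) = (\<one> \<otimes> \<epsilon>) \<bullet> (\<delta> \<bullet> \<mu>)"
    unfolding \<delta>_\<mu> \<kappa>_def by (rule diagram_eqI) simp_all
  also have "\<dots> = ((\<one> \<otimes> \<epsilon>) \<bullet> \<delta>) \<bullet> \<mu>" by simp
  finally show ?thesis by (simp add: counit_right)
qed

text \<open>Expand \<open>1_2 b\<close> as \<open>\<epsilon>(1_2 b_1) 1_3 b_2\<close> by
  \<open>counit_left_\<mu>\<close>, and the triple coproduct of the unit as
  \<open>1_1 \<otimes> 1_2 1'_1 \<otimes> 1'_2\<close>. Associativity moves \<open>1'_1\<close> over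
  to \<open>b_1\<close>; then \<open>1'_1 b_1 \<otimes> 1'_2 b_2\<close> is the coproduct of
  \<open>1 b = b\<close>, and what remains is
  \<open>1_1 \<epsilon>(1_2 b_1) \<otimes> b_2\<close>.\<close>

lemma barPiL_\<delta>: "(barPiL \<otimes> \<one>) \<bullet> \<delta> = (\<one> \<otimes> \<mu>) \<bullet> ((\<delta> \<bullet> \<eta>) \<otimes> \<one>)"
proof -
  have *: "(\<one> \<otimes> \<delta>) \<bullet> \<delta> \<bullet> \<eta> = (\<one> \<otimes> \<mu> \<otimes> \<one>) \<bullet> ((\<delta> \<bullet> \<eta>) \<otimes> (\<delta> \<bullet> \<eta>))"
    using \<delta>_\<delta>_\<eta> coassoc by (simp flip: wcomp_assoc)
  have "(\<one> \<otimes> \<mu>) \<bullet> ((\<delta> \<bullet> \<eta>) \<otimes> \<one>)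
      = (\<one> \<otimes> ((\<kappa> \<otimes> \<mu>) \<bullet> (\<one> \<otimes> \<c> \<otimes> \<one>) \<bullet> (\<delta> \<otimes> \<delta>))) \<bullet> ((\<delta> \<bullet> \<eta>) \<otimes> \<one>)"
    by (simp only: counit_left_\<mu>)
  also have "\<dots> = (\<one> \<otimes> \<kappa> \<otimes> \<mu>) \<bullet> (\<one> \<otimes> \<one> \<otimes> \<c> \<otimes> \<one>) \<bullet> (((\<one> \<otimes> \<delta>) \<bullet> \<delta> \<bullet> \<eta>) \<otimes> \<delta>)"
    by (rule diagram_eqI) simp_all
  also have "\<dots> = (\<one> \<otimes> (\<kappa> \<bullet> (\<mu> \<otimes> \<one>)) \<otimes> \<mu>) \<bullet> (\<one> \<otimes> \<one> \<otimes> \<one> \<otimes> \<c> \<otimes> \<one>)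
      \<bullet> ((\<delta> \<bullet> \<eta>) \<otimes> (\<delta> \<bullet> \<eta>) \<otimes> \<delta>)"
    unfolding * by (rule diagram_eqI) simp_all
  also have "\<dots> = (\<one> \<otimes> \<kappa> \<otimes> \<one>) \<bullet> ((\<delta> \<bullet> \<eta>)
      \<otimes> (((\<mu> \<otimes> \<mu>) \<bullet> (\<one> \<otimes> \<c> \<otimes> \<one>) \<bullet> (\<delta> \<otimes> \<delta>)) \<bullet> (\<eta> \<otimes> \<one>)))"
    unfolding \<kappa>_assoc by (rule diagram_eqI) simp_all
  also have "\<dots> = (\<one> \<otimes> \<kappa> \<otimes> \<one>) \<bullet> ((\<delta> \<bullet> \<eta>) \<otimes> (\<delta> \<bullet> (\<mu> \<bullet> (\<eta> \<otimes> \<one>))))"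
    unfolding \<delta>_\<mu>[symmetric] by simp
  also have "\<dots> = (barPiL \<otimes> \<one>) \<bullet> \<delta>"
    unfolding unit_left barPiL_def by (rule diagram_eqI) simp_all
  finally show ?thesis ..
qed

text \<open>Weak multiplicativity of the counit with the unit in the middle:
  \<open>\<epsilon>(x 1_1) \<epsilon>(1_2 b) = \<epsilon>(x 1 b)\<close>.\<close>

lemma \<kappa>_barPiL: "\<kappa> \<bullet> (\<one> \<otimes> barPiL) = \<kappa>"
proof -
  have "\<kappa> \<bullet> (\<one> \<otimes> barPiL) = ((\<kappa> \<otimes> \<kappa>) \<bullet> (\<one> \<otimes> \<delta> \<otimes> \<one>)) \<bullet> (\<one> \<otimes> \<eta> \<otimes> \<one>)"
    unfolding barPiL_def by (rule diagram_eqI) simp_all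
  also have "\<dots> = \<kappa> \<bullet> ((\<mu> \<bullet> (\<one> \<otimes> \<eta>)) \<otimes> \<one>)"
    unfolding \<kappa>_\<mu>[symmetric] by (rule diagram_eqI) simp_all
  finally show ?thesis by (simp add: unit_right)
qed

lemma wbraid_expand:
  "wbraid [X] [X, X] = (\<one> \<otimes> \<c>) \<bullet> (\<c> \<otimes> \<one>)"
  "wbraid [X, X] [X] = (\<c> \<otimes> \<one>) \<bullet> (\<one> \<otimes> \<c>)"
  using wbraid_append(1)[of "[X]" "[X]" "[X]"] wbraid_append(2)[of "[X]" "[X]" "[X]"] by simp_all

text \<open>The map \<open>PiL_w\<close> sees its argument only inside
  \<open>\<epsilon>(1_1 x b)\<close>. Naturality moves \<open>barPiL\<close> past the braiding, and
  \<open>\<kappa>_barPiL\<close> absorbs it.\<close>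

lemma PiL_\<mu>_barPiL: "PiL_w \<bullet> \<mu> \<bullet> (\<one> \<otimes> barPiL) = PiL_w \<bullet> \<mu>"
proof -
  have nat1: "\<c> \<bullet> (\<one> \<otimes> \<mu>) = (\<mu> \<otimes> \<one>) \<bullet> wbraid [X] [X, X]"
    by (rule wbraid_nat) simp_all
  have nat2: "wbraid [X] [X, X] \<bullet> (\<one> \<otimes> (\<one> \<otimes> barPiL)) = ((\<one> \<otimes> barPiL) \<otimes> \<one>) \<bullet> wbraid [X] [X, X]"
    by (rule wbraid_nat) simp_all
  have PiL: "PiL_w \<bullet> \<mu> = ((\<kappa> \<bullet> (\<mu> \<otimes> \<one>)) \<otimes> \<one>) \<bullet> (\<one> \<otimes> wbraid [X] [X, X]) \<bullet> ((\<delta> \<bullet> \<eta>) \<otimes> \<one> \<otimes> \<one>)"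
  proof -
    have "PiL_w \<bullet> \<mu> = (\<kappa> \<otimes> \<one>) \<bullet> (\<one> \<otimes> (\<c> \<bullet> (\<one> \<otimes> \<mu>))) \<bullet> ((\<delta> \<bullet> \<eta>) \<otimes> \<one> \<otimes> \<one>)"
      unfolding PiL_w_def by (rule diagram_eqI) simp_all
    also have "\<dots> = ((\<kappa> \<bullet> (\<one> \<otimes> \<mu>)) \<otimes> \<one>) \<bullet> (\<one> \<otimes> wbraid [X] [X, X]) \<bullet> ((\<delta> \<bullet> \<eta>) \<otimes> \<one> \<otimes> \<one>)"
      unfolding nat1 by (rule diagram_eqI) simp_all
    finally show ?thesis by (simp only: \<kappa>_assoc)
  qed
  have "PiL_w \<bullet> \<mu> \<bullet> (\<one> \<otimes> barPiL) = (PiL_w \<bullet> \<mu>) \<bullet> (\<one> \<otimes> barPiL)" by simp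
  also have "\<dots> = ((\<kappa> \<bullet> (\<mu> \<otimes> \<one>)) \<otimes> \<one>) \<bullet> (\<one> \<otimes> (wbraid [X] [X, X] \<bullet> (\<one> \<otimes> (\<one> \<otimes> barPiL))))
      \<bullet> ((\<delta> \<bullet> \<eta>) \<otimes> \<one> \<otimes> \<one>)"
    unfolding PiL by (rule diagram_eqI) simp_all
  also have "\<dots> = (((\<kappa> \<bullet> (\<one> \<otimes> barPiL)) \<bullet> (\<mu> \<otimes> \<one>)) \<otimes> \<one>) \<bullet> (\<one> \<otimes> wbraid [X] [X, X])
      \<bullet> ((\<delta> \<bullet> \<eta>) \<otimes> \<one> \<otimes> \<one>)"
    unfolding nat2 by (rule diagram_eqI) simp_all
  finally show ?thesis by (simp only: \<kappa>_barPiL PiL)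
qed

lemma \<epsilon>_PiL: "\<epsilon> \<bullet> PiL_w = \<epsilon>"
proof -
  have nat: "(\<one> \<otimes> \<epsilon>) \<bullet> \<c> = \<epsilon> \<otimes> \<one>"
    using wbraid_nat[of \<epsilon> \<one> "[X]" "[X]" "[]" "[X]"] by simp
  have "\<epsilon> \<bullet> PiL_w = \<kappa> \<bullet> (\<one> \<otimes> ((\<one> \<otimes> \<epsilon>) \<bullet> \<c>)) \<bullet> ((\<delta> \<bullet> \<eta>) \<otimes> \<one>)"
    unfolding PiL_w_def by (rule diagram_eqI) simp_all
  also have "\<dots> = \<kappa> \<bullet> (((\<one> \<otimes> \<epsilon>) \<bullet> \<delta>) \<otimes> \<one>) \<bullet> (\<eta> \<otimes> \<one>)"
    unfolding nat by (rule diagram_eqI) simp_all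
  also have "\<dots> = \<epsilon> \<bullet> (\<mu> \<bullet> (\<eta> \<otimes> \<one>))"
    unfolding counit_right \<kappa>_def by (rule diagram_eqI) simp_all
  finally show ?thesis by (simp add: unit_left)
qed

text \<open>In Sweedler notation \<open>\<rho>(x, b) = b\<^sub>1 \<epsilon>(x b\<^sub>2)\<close>. The inverse-braiding axiom for \<open>\<epsilon>\<close>
  says that \<open>\<epsilon>(x y z) = \<epsilon>(\<rho>(x, y) z)\<close>, which mentions no inverse braiding.\<close>

definition \<rho> where "\<rho> = (\<one> \<otimes> \<kappa>) \<bullet> (\<c> \<otimes> \<one>) \<bullet> (\<one> \<otimes> \<delta>)"

lemma \<rho>_hom: "\<rho> \<in> whom [X, X] [X]"
  by (simp add: \<rho>_def)

lemmas \<rho>_hom_simps [simp] = \<rho>_hom whomD[OF \<rho>_hom]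

lemma PiR_eq_\<rho>: "PiR_w = \<rho> \<bullet> (\<one> \<otimes> \<eta>)"
  unfolding PiR_w_def \<rho>_def by (rule diagram_eqI) simp_all

text \<open>By \<open>cap_wbraid\<close>, the inverse braiding under the first
  \<open>\<kappa>\<close> becomes a braiding on the other side of that \<open>\<kappa>\<close>,
  which is the one in \<open>\<rho>\<close>.\<close>

lemma \<kappa>_\<rho>: "\<kappa> \<bullet> (\<mu> \<otimes> \<one>) = \<kappa> \<bullet> (\<rho> \<otimes> \<one>)"
proof -
  have "\<kappa> \<bullet> (\<mu> \<otimes> \<one>) = (\<kappa> \<otimes> \<kappa>) \<bullet> (\<one> \<otimes> (wibraid [X] [X] \<bullet> \<delta>) \<otimes> \<one>)"
    using \<epsilon>_\<mu>_\<delta>op by (simp add: \<kappa>_def)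
  also have "\<dots> = \<kappa> \<bullet> ((((\<kappa> \<otimes> \<one>) \<bullet> (\<one> \<otimes> wibraid [X] [X])) \<bullet> (\<one> \<otimes> \<delta>)) \<otimes> \<one>)"
    by (rule diagram_eqI) simp_all
  also have "\<dots> = \<kappa> \<bullet> ((((\<one> \<otimes> \<kappa>) \<bullet> (\<c> \<otimes> \<one>)) \<bullet> (\<one> \<otimes> \<delta>)) \<otimes> \<one>)"
    using cap_wbraid[of \<kappa> "[X]" "[X]" "[X]"] by simp
  also have "\<dots> = \<kappa> \<bullet> (\<rho> \<otimes> \<one>)"
    unfolding \<rho>_def by simp
  finally show ?thesis .
qed

text \<open>Coassociativity: both sides are \<open>b_1 \<otimes> b_2 \<epsilon>(x b_3)\<close>, once
  naturality has carried the coproduct through the braiding.\<close>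

lemma \<delta>_\<rho>: "\<delta> \<bullet> \<rho> = (\<one> \<otimes> \<rho>) \<bullet> (\<c> \<otimes> \<one>) \<bullet> (\<one> \<otimes> \<delta>)"
proof -
  have nat: "(\<delta> \<otimes> \<one>) \<bullet> \<c> = ((\<one> \<otimes> \<c>) \<bullet> (\<c> \<otimes> \<one>)) \<bullet> (\<one> \<otimes> \<delta>)"
    unfolding wbraid_expand[symmetric] by (rule wbraid_nat[symmetric]) simp_all
  have "\<delta> \<bullet> \<rho> = (\<one> \<otimes> \<one> \<otimes> \<kappa>) \<bullet> (((\<delta> \<otimes> \<one>) \<bullet> \<c>) \<otimes> \<one>) \<bullet> (\<one> \<otimes> \<delta>)"
    unfolding \<rho>_def by (rule diagram_eqI) simp_all
  also have "\<dots> = (\<one> \<otimes> \<one> \<otimes> \<kappa>) \<bullet> (\<one> \<otimes> \<c> \<otimes> \<one>) \<bullet> (\<c> \<otimes> \<one> \<otimes> \<one>) \<bullet> (\<one> \<otimes> ((\<delta> \<otimes> \<one>) \<bullet> \<delta>))"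
    unfolding nat by (rule diagram_eqI) simp_all
  also have "\<dots> = (\<one> \<otimes> \<rho>) \<bullet> (\<c> \<otimes> \<one>) \<bullet> (\<one> \<otimes> \<delta>)"
    unfolding coassoc \<rho>_def by (rule diagram_eqI) simp_all
  finally show ?thesis .
qed

text \<open>Expanding the coproduct of \<open>a b\<close> gives
  \<open>a_1 b_1 \<epsilon>(x a_2 b_2)\<close>, which is
  \<open>a_1 b_1 \<epsilon>(\<rho>(x, a_2) b_2)\<close> by \<open>\<kappa>_\<rho>\<close>. By
  \<open>\<delta>_\<rho>\<close> the legs \<open>a_1\<close> and \<open>\<rho>(x, a_2)\<close> form
  the coproduct of \<open>\<rho>(x, a)\<close>, so \<open>counit_right_\<mu>\<close> leaves
  \<open>\<rho>(x, a) b\<close>.\<close>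

lemma \<rho>_\<mu>: "\<rho> \<bullet> (\<one> \<otimes> \<mu>) = \<mu> \<bullet> (\<rho> \<otimes> \<one>)"
proof -
  have nat1: "\<c> \<bullet> (\<one> \<otimes> \<mu>) = (\<mu> \<otimes> \<one>) \<bullet> (\<one> \<otimes> \<c>) \<bullet> (\<c> \<otimes> \<one>)"
    unfolding wbraid_expand[symmetric] by (rule wbraid_nat) simp_all
  have nat2: "(\<one> \<otimes> \<rho>) \<bullet> (\<c> \<otimes> \<one>) \<bullet> (\<one> \<otimes> \<c>) = \<c> \<bullet> (\<rho> \<otimes> \<one>)"
    unfolding wbraid_expand[symmetric] by (rule wbraid_nat[symmetric]) simp_all
  have \<kappa>: "\<kappa> \<bullet> (\<one> \<otimes> \<mu>) = \<kappa> \<bullet> (\<rho> \<otimes> \<one>)"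
    by (simp only: \<kappa>_assoc[symmetric] \<kappa>_\<rho>)
  have "\<rho> \<bullet> (\<one> \<otimes> \<mu>) = (\<one> \<otimes> \<kappa>) \<bullet> (\<c> \<otimes> \<one>) \<bullet> (\<one> \<otimes> (\<delta> \<bullet> \<mu>))"
    unfolding \<rho>_def by (rule diagram_eqI) simp_all
  also have "\<dots> = (\<one> \<otimes> \<kappa>) \<bullet> ((\<c> \<bullet> (\<one> \<otimes> \<mu>)) \<otimes> \<mu>) \<bullet> (\<one> \<otimes> \<one> \<otimes> \<c> \<otimes> \<one>) \<bullet> (\<one> \<otimes> \<delta> \<otimes> \<delta>)"
    unfolding \<delta>_\<mu> by (rule diagram_eqI) simp_all
  also have "\<dots> = (\<mu> \<otimes> (\<kappa> \<bullet> (\<one> \<otimes> \<mu>))) \<bullet> (\<one> \<otimes> \<c> \<otimes> \<one> \<otimes> \<one>) \<bullet> (\<one> \<otimes> \<one> \<otimes> \<c> \<otimes> \<one>)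
      \<bullet> (\<c> \<otimes> \<one> \<otimes> \<one> \<otimes> \<one>) \<bullet> (\<one> \<otimes> \<delta> \<otimes> \<delta>)"
    unfolding nat1 by (rule diagram_eqI) simp_all
  also have "\<dots> = (\<mu> \<otimes> \<kappa>) \<bullet> (\<one> \<otimes> ((\<one> \<otimes> \<rho>) \<bullet> (\<c> \<otimes> \<one>) \<bullet> (\<one> \<otimes> \<c>)) \<otimes> \<one>)
      \<bullet> (\<c> \<otimes> \<one> \<otimes> \<one> \<otimes> \<one>) \<bullet> (\<one> \<otimes> \<delta> \<otimes> \<delta>)"
    unfolding \<kappa> by (rule diagram_eqI) simp_all
  also have "\<dots> = (\<mu> \<otimes> \<kappa>) \<bullet> (\<one> \<otimes> \<c> \<otimes> \<one>) \<bullet> (((\<one> \<otimes> \<rho>) \<bullet> (\<c> \<otimes> \<one>) \<bullet> (\<one> \<otimes> \<delta>)) \<otimes> \<delta>)"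
    unfolding nat2 by (rule diagram_eqI) simp_all
  also have "\<dots> = ((\<mu> \<otimes> \<kappa>) \<bullet> (\<one> \<otimes> \<c> \<otimes> \<one>) \<bullet> (\<delta> \<otimes> \<delta>)) \<bullet> (\<rho> \<otimes> \<one>)"
    unfolding \<delta>_\<rho>[symmetric] by (rule diagram_eqI) simp_all
  finally show ?thesis by (simp only: counit_right_\<mu>)
qed

text \<open>Since \<open>PiR_w(x)\<close> is \<open>\<rho>(x, 1)\<close>, this is
  \<open>\<rho>_\<mu>\<close> with the unit as left factor.\<close>

lemma \<mu>_PiR: "\<mu> \<bullet> (PiR_w \<otimes> \<one>) = \<rho>"
proof -
  have "\<mu> \<bullet> (PiR_w \<otimes> \<one>) = (\<mu> \<bullet> (\<rho> \<otimes> \<one>)) \<bullet> (\<one> \<otimes> \<eta> \<otimes> \<one>)"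
    unfolding PiR_eq_\<rho> by (rule diagram_eqI) simp_all
  also have "\<dots> = \<rho> \<bullet> (\<one> \<otimes> (\<mu> \<bullet> (\<eta> \<otimes> \<one>)))"
    unfolding \<rho>_\<mu>[symmetric] by (rule diagram_eqI) simp_all
  finally show ?thesis by (simp add: unit_left)
qed

text \<open>The left side is \<open>b_1 1_1 \<epsilon>(x b_2 1_2)\<close>, and
  \<open>b_1 1_1 \<otimes> b_2 1_2\<close> is the coproduct of \<open>b 1 = b\<close>. Together with
  \<open>\<mu>_PiR\<close> this yields \<open>b_1 PiR_w(x b_2) = PiR_w(x) b\<close>.\<close>

lemma \<mu>_PiR_\<mu>: "\<mu> \<bullet> (\<one> \<otimes> (PiR_w \<bullet> \<mu>)) \<bullet> (\<c> \<otimes> \<one>) \<bullet> (\<one> \<otimes> \<delta>) = \<rho>"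
proof -
  have nat1: "\<c> \<bullet> (\<one> \<otimes> \<mu>) = (\<mu> \<otimes> \<one>) \<bullet> (\<one> \<otimes> \<c>) \<bullet> (\<c> \<otimes> \<one>)"
    unfolding wbraid_expand[symmetric] by (rule wbraid_nat) simp_all
  have nat2: "\<c> \<bullet> (\<mu> \<otimes> \<one>) = (\<one> \<otimes> \<mu>) \<bullet> (\<c> \<otimes> \<one>) \<bullet> (\<one> \<otimes> \<c>)"
    unfolding wbraid_expand[symmetric] by (rule wbraid_nat) simp_all
  have "\<mu> \<bullet> (\<one> \<otimes> (PiR_w \<bullet> \<mu>)) \<bullet> (\<c> \<otimes> \<one>) \<bullet> (\<one> \<otimes> \<delta>)
      = (\<mu> \<otimes> \<kappa>) \<bullet> (\<one> \<otimes> (\<c> \<bullet> (\<mu> \<otimes> \<one>)) \<otimes> \<one>) \<bullet> (\<c> \<otimes> \<one> \<otimes> \<one> \<otimes> \<one>) \<bullet> (\<one> \<otimes> \<delta> \<otimes> (\<delta> \<bullet> \<eta>))"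
    unfolding PiR_w_def by (rule diagram_eqI) simp_all
  also have "\<dots> = (\<mu> \<otimes> (\<kappa> \<bullet> (\<mu> \<otimes> \<one>))) \<bullet> (\<one> \<otimes> \<c> \<otimes> \<one> \<otimes> \<one>) \<bullet> (\<c> \<otimes> \<c> \<otimes> \<one>) \<bullet> (\<one> \<otimes> \<delta> \<otimes> (\<delta> \<bullet> \<eta>))"
    unfolding nat2 by (rule diagram_eqI) simp_all
  also have "\<dots> = (\<one> \<otimes> \<kappa>) \<bullet> (((\<mu> \<otimes> \<one>) \<bullet> (\<one> \<otimes> \<c>) \<bullet> (\<c> \<otimes> \<one>)) \<otimes> \<mu>)
      \<bullet> (\<one> \<otimes> \<one> \<otimes> \<c> \<otimes> \<one>) \<bullet> (\<one> \<otimes> \<delta> \<otimes> (\<delta> \<bullet> \<eta>))"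
    unfolding \<kappa>_assoc by (rule diagram_eqI) simp_all
  also have "\<dots> = ((\<one> \<otimes> \<kappa>) \<bullet> (\<c> \<otimes> \<one>)) \<bullet> (\<one> \<otimes> (((\<mu> \<otimes> \<mu>) \<bullet> (\<one> \<otimes> \<c> \<otimes> \<one>) \<bullet> (\<delta> \<otimes> \<delta>)) \<bullet> (\<one> \<otimes> \<eta>)))"
    unfolding nat1[symmetric] by (rule diagram_eqI) simp_all
  also have "\<dots> = ((\<one> \<otimes> \<kappa>) \<bullet> (\<c> \<otimes> \<one>)) \<bullet> (\<one> \<otimes> (\<delta> \<bullet> (\<mu> \<bullet> (\<one> \<otimes> \<eta>))))"
    unfolding \<delta>_\<mu>[symmetric] by (rule diagram_eqI) simp_all
  also have "\<dots> = \<rho>"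
    unfolding unit_right \<rho>_def by (rule diagram_eqI) simp_all
  finally show ?thesis .
qed

lemma id_conv_PiR: "\<mu> \<bullet> (\<one> \<otimes> PiR_w) \<bullet> \<delta> = \<one>"
proof -
  have "\<mu> \<bullet> (\<one> \<otimes> PiR_w) \<bullet> \<delta>
      = ((\<mu> \<otimes> \<kappa>) \<bullet> (\<one> \<otimes> \<c> \<otimes> \<one>) \<bullet> (\<delta> \<otimes> \<delta>)) \<bullet> (\<one> \<otimes> \<eta>)"
    unfolding PiR_w_def by (rule diagram_eqI) simp_all
  then show ?thesis by (simp only: counit_right_\<mu> unit_right)
qed

end

section \<open>Weak Hopf algebras: an identity for the antipode\<close>

locale weak_hopf_words = weak_bialgebra_words C X \<eta> \<mu> \<epsilon> \<delta>
  for C :: "('o, 'm) bcat" and X \<eta> \<mu> \<epsilon> \<delta> +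
  fixes S :: "('o, 'm) warr"
  assumes S_hom: "S \<in> whom [X] [X]"
    and id_conv_S: "\<mu> \<bullet> (wid [X] \<otimes> S) \<bullet> \<delta> = PiL_w"
    and S_conv_id: "\<mu> \<bullet> (S \<otimes> wid [X]) \<bullet> \<delta> = PiR_w"
    \<comment> \<open>This is the axiom that the convolution of \<open>S\<close>, the identity and
      \<open>S\<close> is \<open>S\<close>, with the first two factors already replaced by
      \<open>PiR_w\<close>.\<close>
    and PiR_conv_S: "\<mu> \<bullet> (PiR_w \<otimes> S) \<bullet> \<delta> = S"
begin

lemmas S_hom_simps [simp] = S_hom whomD[OF S_hom]

text \<open>In Sweedler notation \<open>\<phi>(x, b) = b\<^sub>1 S(x b\<^sub>2)\<close>.\<close>

definition \<phi> where "\<phi> = \<mu> \<bullet> (\<one> \<otimes> (S \<bullet> \<mu>)) \<bullet> (\<c> \<otimes> \<one>) \<bullet> (\<one> \<otimes> \<delta>)"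

lemma \<phi>_hom: "\<phi> \<in> whom [X, X] [X]"
  by (simp add: \<phi>_def)

lemmas \<phi>_hom_simps [simp] = \<phi>_hom whomD[OF \<phi>_hom]

text \<open>Insert \<open>S(y) = PiR_w(y_1) S(y_2)\<close> for \<open>y = x b_2\<close>, so that
  \<open>b_1 PiR_w(x_1 b_2) S(x_2 b_3)\<close> appears. This equals
  \<open>PiR_w(x_1) b_1 S(x_2 b_2)\<close>, and opening \<open>PiR_w(x_1)\<close> as
  \<open>S(x_1) x_2\<close> leaves \<open>S(x_1)\<close> times the convolution of the identity with
  \<open>S\<close> at \<open>x_2 b\<close>, which is \<open>PiL_w\<close>.\<close>

lemma \<phi>_eq: "\<phi> = \<mu> \<bullet> (S \<otimes> (PiL_w \<bullet> \<mu>)) \<bullet> (\<delta> \<otimes> \<one>)"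
proof -
  have nat1: "(\<one> \<otimes> \<delta>) \<bullet> \<c> = (\<c> \<otimes> \<one>) \<bullet> (\<one> \<otimes> \<c>) \<bullet> (\<delta> \<otimes> \<one>)"
    using wbraid_nat[of \<delta> \<one> "[X]" "[X]" "[X,X]" "[X]"] by (simp add: wbraid_expand)
  have nat2: "(\<one> \<otimes> \<c>) \<bullet> (\<c> \<otimes> \<one>) \<bullet> (\<one> \<otimes> \<delta>) = (\<delta> \<otimes> \<one>) \<bullet> \<c>"
    using wbraid_nat[of \<one> \<delta> "[X]" "[X]" "[X]" "[X,X]"] by (simp add: wbraid_expand)
  have "\<phi> = \<mu> \<bullet> (\<one> \<otimes> ((\<mu> \<bullet> (PiR_w \<otimes> S) \<bullet> \<delta>) \<bullet> \<mu>)) \<bullet> (\<c> \<otimes> \<one>) \<bullet> (\<one> \<otimes> \<delta>)"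
    unfolding PiR_conv_S \<phi>_def ..
  also have "\<dots> = \<mu> \<bullet> (\<one> \<otimes> (\<mu> \<bullet> (PiR_w \<otimes> S) \<bullet> (\<delta> \<bullet> \<mu>))) \<bullet> (\<c> \<otimes> \<one>) \<bullet> (\<one> \<otimes> \<delta>)"
    by (rule diagram_eqI) simp_all
  also have "\<dots> = (\<mu> \<bullet> (\<one> \<otimes> \<mu>)) \<bullet> (\<one> \<otimes> (PiR_w \<bullet> \<mu>) \<otimes> (S \<bullet> \<mu>)) \<bullet> (\<one> \<otimes> \<one> \<otimes> \<c> \<otimes> \<one>)
      \<bullet> (((\<one> \<otimes> \<delta>) \<bullet> \<c>) \<otimes> \<one> \<otimes> \<one>) \<bullet> (\<one> \<otimes> ((\<one> \<otimes> \<delta>) \<bullet> \<delta>))"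
    unfolding \<delta>_\<mu> by (rule diagram_eqI) simp_all
  also have "\<dots> = (\<mu> \<bullet> (\<mu> \<otimes> \<one>)) \<bullet> (\<one> \<otimes> (PiR_w \<bullet> \<mu>) \<otimes> (S \<bullet> \<mu>)) \<bullet> (\<one> \<otimes> \<one> \<otimes> \<c> \<otimes> \<one>)
      \<bullet> (\<c> \<otimes> \<one> \<otimes> \<one> \<otimes> \<one>) \<bullet> (\<one> \<otimes> \<c> \<otimes> \<one> \<otimes> \<one>) \<bullet> (\<delta> \<otimes> ((\<delta> \<otimes> \<one>) \<bullet> \<delta>))"
    unfolding nat1 coassoc[symmetric] assoc by (rule diagram_eqI) simp_all
  also have "\<dots> = \<mu> \<bullet> ((\<mu> \<bullet> (\<one> \<otimes> (PiR_w \<bullet> \<mu>)) \<bullet> (\<c> \<otimes> \<one>)) \<otimes> (S \<bullet> \<mu>))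
      \<bullet> (\<one> \<otimes> ((\<one> \<otimes> \<c>) \<bullet> (\<c> \<otimes> \<one>) \<bullet> (\<one> \<otimes> \<delta>)) \<otimes> \<one>) \<bullet> (\<delta> \<otimes> \<delta>)"
    by (rule diagram_eqI) simp_all
  also have "\<dots> = \<mu> \<bullet> ((\<mu> \<bullet> (\<one> \<otimes> (PiR_w \<bullet> \<mu>)) \<bullet> (\<c> \<otimes> \<one>) \<bullet> (\<one> \<otimes> \<delta>)) \<otimes> (S \<bullet> \<mu>))
      \<bullet> (\<one> \<otimes> \<c> \<otimes> \<one>) \<bullet> (\<delta> \<otimes> \<delta>)"
    unfolding nat2 by (rule diagram_eqI) simp_all
  \<comment> \<open>Both \<open>b_1 PiR_w(x b_2)\<close> and \<open>S(x_1) x_2 b\<close> reduce to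
    \<open>\<rho>(x, b)\<close>, so one may replace the other.\<close>
  also have "\<dots> = \<mu> \<bullet> ((\<mu> \<bullet> ((\<mu> \<bullet> (S \<otimes> \<one>) \<bullet> \<delta>) \<otimes> \<one>)) \<otimes> (S \<bullet> \<mu>)) \<bullet> (\<one> \<otimes> \<c> \<otimes> \<one>) \<bullet> (\<delta> \<otimes> \<delta>)"
    unfolding \<mu>_PiR_\<mu> S_conv_id \<mu>_PiR ..
  also have "\<dots> = \<mu> \<bullet> ((\<mu> \<bullet> (\<mu> \<otimes> \<one>)) \<otimes> \<one>) \<bullet> (S \<otimes> \<one> \<otimes> \<one> \<otimes> (S \<bullet> \<mu>)) \<bullet> (\<one> \<otimes> \<one> \<otimes> \<c> \<otimes> \<one>)
      \<bullet> (((\<delta> \<otimes> \<one>) \<bullet> \<delta>) \<otimes> \<delta>)"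
    by (rule diagram_eqI) simp_all
  also have "\<dots> = \<mu> \<bullet> (\<mu> \<otimes> \<one>) \<bullet> (S \<otimes> \<mu> \<otimes> (S \<bullet> \<mu>)) \<bullet> (\<one> \<otimes> \<one> \<otimes> \<c> \<otimes> \<one>)
      \<bullet> (((\<one> \<otimes> \<delta>) \<bullet> \<delta>) \<otimes> \<delta>)"
    unfolding assoc coassoc by (rule diagram_eqI) simp_all
  also have "\<dots> = (\<mu> \<bullet> (\<mu> \<otimes> \<one>)) \<bullet> (S \<otimes> \<mu> \<otimes> (S \<bullet> \<mu>)) \<bullet> (\<one> \<otimes> \<one> \<otimes> \<c> \<otimes> \<one>)
      \<bullet> (((\<one> \<otimes> \<delta>) \<bullet> \<delta>) \<otimes> \<delta>)"
    by simp
  also have "\<dots> = \<mu> \<bullet> (S \<otimes> (\<mu> \<bullet> (\<one> \<otimes> S) \<bullet> ((\<mu> \<otimes> \<mu>) \<bullet> (\<one> \<otimes> \<c> \<otimes> \<one>) \<bullet> (\<delta> \<otimes> \<delta>)))) \<bullet> (\<delta> \<otimes> \<one>)"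
    unfolding assoc by (rule diagram_eqI) simp_all
  also have "\<dots> = \<mu> \<bullet> (S \<otimes> ((\<mu> \<bullet> (\<one> \<otimes> S) \<bullet> \<delta>) \<bullet> \<mu>)) \<bullet> (\<delta> \<otimes> \<one>)"
    unfolding \<delta>_\<mu>[symmetric] by (rule diagram_eqI) simp_all
  finally show ?thesis unfolding id_conv_S .
qed

text \<open>By \<open>\<phi>_eq\<close> the second argument enters only through
  \<open>PiL_w(x_2 b)\<close>, where \<open>PiL_\<mu>_barPiL\<close> applies.\<close>

lemma \<phi>_barPiL: "\<phi> \<bullet> (\<one> \<otimes> barPiL) = \<phi>"
proof -
  have "\<phi> \<bullet> (\<one> \<otimes> barPiL) = \<mu> \<bullet> (S \<otimes> (PiL_w \<bullet> \<mu> \<bullet> (\<one> \<otimes> barPiL))) \<bullet> (\<delta> \<otimes> \<one>)"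
    unfolding \<phi>_eq by (rule diagram_eqI) simp_all
  then show ?thesis unfolding PiL_\<mu>_barPiL \<phi>_eq .
qed

end

section \<open>Weak projections\<close>

locale weak_projection_words =
  strict_braided_cat C + D: weak_bialgebra_words C D \<eta>D \<mu>D \<epsilon>D \<delta>D +
  B: weak_hopf_words C B \<eta>B \<mu>B \<epsilon>B \<delta>B S
  for C :: "('o, 'm) bcat" and D \<eta>D \<mu>D \<epsilon>D \<delta>D B \<eta>B \<mu>B \<epsilon>B \<delta>B S +
  fixes f g p i :: "('o, 'm) warr" and Q :: 'o
  assumes f_hom: "f \<in> whom [B] [D]" and g_hom: "g \<in> whom [D] [B]"
    and p_hom: "p \<in> whom [D] [Q]" and i_hom: "i \<in> whom [Q] [D]"
    and f_\<eta>: "f \<bullet> \<eta>B = \<eta>D" and f_\<mu>: "f \<bullet> \<mu>B = \<mu>D \<bullet> (f \<otimes> f)"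
    and f_\<delta>: "\<delta>D \<bullet> f = (f \<otimes> f) \<bullet> \<delta>B"
    and g_\<epsilon>: "\<epsilon>B \<bullet> g = \<epsilon>D" and g_\<delta>: "\<delta>B \<bullet> g = (g \<otimes> g) \<bullet> \<delta>D"
    and g_f: "g \<bullet> f = wid [B]"
    and g_\<mu>_f: "g \<bullet> \<mu>D \<bullet> (wid [D] \<otimes> f) = \<mu>B \<bullet> (g \<otimes> wid [B])"
    and i_p: "i \<bullet> p = \<mu>D \<bullet> (wid [D] \<otimes> (f \<bullet> S \<bullet> g)) \<bullet> \<delta>D"
    and p_i: "p \<bullet> i = wid [Q]"
begin

lemmas proj_hom_simps [simp] = f_hom whomD[OF f_hom] g_hom whomD[OF g_hom]
  p_hom whomD[OF p_hom] i_hom whomD[OF i_hom]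

abbreviation oneD ("1D") where "1D \<equiv> wid [D]"
abbreviation oneB ("1B") where "1B \<equiv> wid [B]"
abbreviation oneQ ("1Q") where "1Q \<equiv> wid [Q]"
abbreviation cDD where "cDD \<equiv> wbraid [D] [D]"
abbreviation cDB where "cDB \<equiv> wbraid [D] [B]"
abbreviation cBB where "cBB \<equiv> wbraid [B] [B]"

lemma cDD_f: "cDD \<bullet> (1D \<otimes> f) = (f \<otimes> 1D) \<bullet> cDB"
  by (rule wbraid_nat) simp_all

lemma cBB_g: "cBB \<bullet> (g \<otimes> 1B) = (1B \<otimes> g) \<bullet> cDB"
  by (rule wbraid_nat) simp_all

text \<open>Multiplicativity of both coproduct and \<open>f\<close>, with
  \<open>g(d f(b)) = g(d) b\<close>, turns \<open>t(d f(b))\<close> into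
  \<open>d_1 f(b_1 S(g(d_2) b_2))\<close>, so that \<open>b\<close> enters only through
  \<open>\<phi>\<close>.\<close>

lemma t_\<mu>_f: "(i \<bullet> p) \<bullet> \<mu>D \<bullet> (1D \<otimes> f)
    = \<mu>D \<bullet> (1D \<otimes> f) \<bullet> (1D \<otimes> B.\<phi>) \<bullet> (1D \<otimes> g \<otimes> 1B) \<bullet> (\<delta>D \<otimes> 1B)"
proof -
  have "(i \<bullet> p) \<bullet> \<mu>D \<bullet> (1D \<otimes> f) = \<mu>D \<bullet> (1D \<otimes> (f \<bullet> S \<bullet> g)) \<bullet> (\<delta>D \<bullet> \<mu>D) \<bullet> (1D \<otimes> f)"
    unfolding i_p by (rule diagram_eqI) simp_all
  also have "\<dots> = \<mu>D \<bullet> (\<mu>D \<otimes> (f \<bullet> S \<bullet> g \<bullet> \<mu>D)) \<bullet> (1D \<otimes> cDD \<otimes> 1D) \<bullet> (\<delta>D \<otimes> (\<delta>D \<bullet> f))"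
    unfolding D.\<delta>_\<mu> by (rule diagram_eqI) simp_all
  also have "\<dots> = \<mu>D \<bullet> (\<mu>D \<otimes> (f \<bullet> S \<bullet> (g \<bullet> \<mu>D \<bullet> (1D \<otimes> f)))) \<bullet> (1D \<otimes> (cDD \<bullet> (1D \<otimes> f)) \<otimes> 1B)
      \<bullet> (\<delta>D \<otimes> \<delta>B)"
    unfolding f_\<delta> by (rule diagram_eqI) simp_all
  also have "\<dots> = \<mu>D \<bullet> ((\<mu>D \<bullet> (1D \<otimes> f)) \<otimes> (f \<bullet> S \<bullet> \<mu>B)) \<bullet> (1D \<otimes> ((1B \<otimes> g) \<bullet> cDB) \<otimes> 1B)
      \<bullet> (\<delta>D \<otimes> \<delta>B)"
    unfolding g_\<mu>_f cDD_f by (rule diagram_eqI) simp_all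
  also have "\<dots> = (\<mu>D \<bullet> (\<mu>D \<otimes> 1D)) \<bullet> (1D \<otimes> f \<otimes> f) \<bullet> (1D \<otimes> 1B \<otimes> (S \<bullet> \<mu>B))
      \<bullet> (1D \<otimes> cBB \<otimes> 1B) \<bullet> (1D \<otimes> g \<otimes> 1B \<otimes> 1B) \<bullet> (\<delta>D \<otimes> \<delta>B)"
    unfolding cBB_g[symmetric] by (rule diagram_eqI) simp_all
  also have "\<dots> = \<mu>D \<bullet> (1D \<otimes> (\<mu>D \<bullet> (f \<otimes> f))) \<bullet> (1D \<otimes> 1B \<otimes> (S \<bullet> \<mu>B))
      \<bullet> (1D \<otimes> cBB \<otimes> 1B) \<bullet> (1D \<otimes> g \<otimes> 1B \<otimes> 1B) \<bullet> (\<delta>D \<otimes> \<delta>B)"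
    unfolding D.assoc by (rule diagram_eqI) simp_all
  also have "\<dots> = \<mu>D \<bullet> (1D \<otimes> f) \<bullet> (1D \<otimes> B.\<phi>) \<bullet> (1D \<otimes> g \<otimes> 1B) \<bullet> (\<delta>D \<otimes> 1B)"
    unfolding f_\<mu>[symmetric] B.\<phi>_def by (rule diagram_eqI) simp_all
  finally show ?thesis .
qed

lemma p_i_p: "p \<bullet> i \<bullet> p = p"
proof -
  have "p \<bullet> i \<bullet> p = (p \<bullet> i) \<bullet> p" by simp
  then show ?thesis by (simp add: p_i)
qed

text \<open>As \<open>p\<close> absorbs \<open>i \<bullet> p\<close>, the argument \<open>b\<close>
  is seen only through \<open>\<phi>\<close>, which is invariant under
  \<open>barPiL\<close>.\<close>

lemma p_\<mu>_f: "p \<bullet> \<mu>D \<bullet> (1D \<otimes> f) = p \<bullet> \<mu>D \<bullet> (1D \<otimes> (f \<bullet> B.barPiL))"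
proof -
  have "p \<bullet> \<mu>D \<bullet> (1D \<otimes> f) = (p \<bullet> i \<bullet> p) \<bullet> \<mu>D \<bullet> (1D \<otimes> f)"
    unfolding p_i_p ..
  also have "\<dots> = p \<bullet> ((i \<bullet> p) \<bullet> \<mu>D \<bullet> (1D \<otimes> f))" by simp
  also have "\<dots> = p \<bullet> \<mu>D \<bullet> (1D \<otimes> f) \<bullet> (1D \<otimes> (B.\<phi> \<bullet> (1B \<otimes> B.barPiL))) \<bullet> (1D \<otimes> g \<otimes> 1B) \<bullet> (\<delta>D \<otimes> 1B)"
    unfolding t_\<mu>_f B.\<phi>_barPiL ..
  also have "\<dots> = p \<bullet> (\<mu>D \<bullet> (1D \<otimes> f) \<bullet> (1D \<otimes> B.\<phi>) \<bullet> (1D \<otimes> g \<otimes> 1B) \<bullet> (\<delta>D \<otimes> 1B)) \<bullet> (1D \<otimes> B.barPiL)"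
    by (rule diagram_eqI) simp_all
  also have "\<dots> = (p \<bullet> i \<bullet> p) \<bullet> \<mu>D \<bullet> (1D \<otimes> (f \<bullet> B.barPiL))"
    unfolding t_\<mu>_f[symmetric] by (rule diagram_eqI) simp_all
  finally show ?thesis unfolding p_i_p .
qed

text \<open>In \<open>p(d_1 f(b_1)) \<otimes> d_2 f(b_2)\<close> the leg \<open>b_1\<close> may be
  replaced by \<open>barPiL(b_1)\<close>, and \<open>barPiL_\<delta>\<close> turns this into
  \<open>p(d_1 f(1_1)) \<otimes> d_2 f(1_2 b)\<close>. Because \<open>f\<close> preserves unit,
  product and coproduct, \<open>f(1_1) \<otimes> f(1_2)\<close> is the coproduct of the unit of
  \<open>D\<close> and is absorbed by that of \<open>d\<close>.\<close>

lemma p_\<delta>_\<mu>_f: "(p \<otimes> 1D) \<bullet> \<delta>D \<bullet> \<mu>D \<bullet> (1D \<otimes> f) = (1Q \<otimes> \<mu>D) \<bullet> (((p \<otimes> 1D) \<bullet> \<delta>D) \<otimes> f)"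
proof -
  have nat: "(B.barPiL \<otimes> 1D) \<bullet> cDB = cDB \<bullet> (1D \<otimes> B.barPiL)"
    by (rule wbraid_nat[symmetric]) simp_all
  have "(p \<otimes> 1D) \<bullet> \<delta>D \<bullet> \<mu>D \<bullet> (1D \<otimes> f) = (p \<otimes> 1D) \<bullet> (\<delta>D \<bullet> \<mu>D) \<bullet> (1D \<otimes> f)"
    by (rule diagram_eqI) simp_all
  also have "\<dots> = (p \<otimes> 1D) \<bullet> (\<mu>D \<otimes> \<mu>D) \<bullet> (1D \<otimes> cDD \<otimes> 1D) \<bullet> (\<delta>D \<otimes> (\<delta>D \<bullet> f))"
    unfolding D.\<delta>_\<mu> by (rule diagram_eqI) simp_all
  also have "\<dots> = (p \<otimes> 1D) \<bullet> (\<mu>D \<otimes> \<mu>D) \<bullet> (1D \<otimes> (cDD \<bullet> (1D \<otimes> f)) \<otimes> f) \<bullet> (\<delta>D \<otimes> \<delta>B)"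
    unfolding f_\<delta> by (rule diagram_eqI) simp_all
  also have "\<dots> = ((p \<bullet> \<mu>D \<bullet> (1D \<otimes> f)) \<otimes> \<mu>D) \<bullet> (1D \<otimes> cDB \<otimes> f) \<bullet> (\<delta>D \<otimes> \<delta>B)"
    unfolding cDD_f by (rule diagram_eqI) simp_all
  also have "\<dots> = ((p \<bullet> \<mu>D \<bullet> (1D \<otimes> (f \<bullet> B.barPiL))) \<otimes> \<mu>D) \<bullet> (1D \<otimes> cDB \<otimes> f) \<bullet> (\<delta>D \<otimes> \<delta>B)"
    unfolding p_\<mu>_f ..
  also have "\<dots> = ((p \<bullet> \<mu>D \<bullet> (1D \<otimes> f)) \<otimes> \<mu>D) \<bullet> (1D \<otimes> ((B.barPiL \<otimes> 1D) \<bullet> cDB) \<otimes> f) \<bullet> (\<delta>D \<otimes> \<delta>B)"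
    by (rule diagram_eqI) simp_all
  also have "\<dots> = ((p \<bullet> \<mu>D \<bullet> (1D \<otimes> f)) \<otimes> \<mu>D) \<bullet> (1D \<otimes> cDB \<otimes> f) \<bullet> (\<delta>D \<otimes> ((B.barPiL \<otimes> 1B) \<bullet> \<delta>B))"
    unfolding nat by (rule diagram_eqI) simp_all
  also have "\<dots> = ((p \<bullet> \<mu>D) \<otimes> \<mu>D) \<bullet> (1D \<otimes> ((f \<otimes> 1D) \<bullet> cDB) \<otimes> (f \<bullet> \<mu>B)) \<bullet> (\<delta>D \<otimes> (\<delta>B \<bullet> \<eta>B) \<otimes> 1B)"
    unfolding B.barPiL_\<delta> by (rule diagram_eqI) simp_all
  also have "\<dots> = ((p \<bullet> \<mu>D) \<otimes> \<mu>D) \<bullet> (1D \<otimes> cDD \<otimes> \<mu>D) \<bullet> (\<delta>D \<otimes> (((f \<otimes> f) \<bullet> \<delta>B) \<bullet> \<eta>B) \<otimes> f)"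
    unfolding cDD_f[symmetric] f_\<mu> by (rule diagram_eqI) simp_all
  also have "\<dots> = (p \<otimes> (\<mu>D \<bullet> (1D \<otimes> \<mu>D))) \<bullet> (\<mu>D \<otimes> 1D \<otimes> 1D \<otimes> 1D) \<bullet> (1D \<otimes> cDD \<otimes> 1D \<otimes> 1D)
     \<bullet> (\<delta>D \<otimes> (\<delta>D \<bullet> (f \<bullet> \<eta>B)) \<otimes> f)"
    unfolding f_\<delta>[symmetric] by (rule diagram_eqI) simp_all
  also have "\<dots> = (p \<otimes> \<mu>D) \<bullet> ((((\<mu>D \<otimes> \<mu>D) \<bullet> (1D \<otimes> cDD \<otimes> 1D) \<bullet> (\<delta>D \<otimes> \<delta>D)) \<bullet> (1D \<otimes> \<eta>D)) \<otimes> f)"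
    unfolding f_\<eta> D.assoc[symmetric] by (rule diagram_eqI) simp_all
  also have "\<dots> = (p \<otimes> \<mu>D) \<bullet> ((\<delta>D \<bullet> (\<mu>D \<bullet> (1D \<otimes> \<eta>D))) \<otimes> f)"
    unfolding D.\<delta>_\<mu>[symmetric] by (rule diagram_eqI) simp_all
  also have "\<dots> = (1Q \<otimes> \<mu>D) \<bullet> (((p \<otimes> 1D) \<bullet> \<delta>D) \<otimes> f)"
    unfolding D.unit_right by (rule diagram_eqI) simp_all
  finally show ?thesis .
qed

text \<open>The projection property gives \<open>\<epsilon>B(g(d) b) = \<epsilon>D(d f(b))\<close>,
  and \<open>f\<close> carries the coproduct of the unit of \<open>B\<close> to that of
  \<open>D\<close>.\<close>

lemma f_PiR_g: "f \<bullet> B.PiR_w \<bullet> g = D.PiR_w"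
proof -
  have \<kappa>: "B.\<kappa> \<bullet> (g \<otimes> 1B) = D.\<kappa> \<bullet> (1D \<otimes> f)"
  proof -
    have "B.\<kappa> \<bullet> (g \<otimes> 1B) = \<epsilon>B \<bullet> (\<mu>B \<bullet> (g \<otimes> 1B))" by (simp add: B.\<kappa>_def)
    also have "\<dots> = (\<epsilon>B \<bullet> g) \<bullet> \<mu>D \<bullet> (1D \<otimes> f)" unfolding g_\<mu>_f[symmetric] by simp
    finally show ?thesis unfolding g_\<epsilon> D.\<kappa>_def by simp
  qed
  have "f \<bullet> B.PiR_w \<bullet> g = (f \<otimes> B.\<kappa>) \<bullet> ((cBB \<bullet> (g \<otimes> 1B)) \<otimes> 1B) \<bullet> (1D \<otimes> (\<delta>B \<bullet> \<eta>B))"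
    unfolding B.PiR_w_def by (rule diagram_eqI) simp_all
  also have "\<dots> = (f \<otimes> (B.\<kappa> \<bullet> (g \<otimes> 1B))) \<bullet> (cDB \<otimes> 1B) \<bullet> (1D \<otimes> (\<delta>B \<bullet> \<eta>B))"
    unfolding cBB_g by (rule diagram_eqI) simp_all
  also have "\<dots> = (1D \<otimes> D.\<kappa>) \<bullet> (((f \<otimes> 1D) \<bullet> cDB) \<otimes> f) \<bullet> (1D \<otimes> (\<delta>B \<bullet> \<eta>B))"
    unfolding \<kappa> by (rule diagram_eqI) simp_all
  also have "\<dots> = (1D \<otimes> D.\<kappa>) \<bullet> (cDD \<otimes> 1D) \<bullet> (1D \<otimes> (((f \<otimes> f) \<bullet> \<delta>B) \<bullet> \<eta>B))"
    unfolding cDD_f[symmetric] by (rule diagram_eqI) simp_all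
  also have "\<dots> = (1D \<otimes> D.\<kappa>) \<bullet> (cDD \<otimes> 1D) \<bullet> (1D \<otimes> (\<delta>D \<bullet> (f \<bullet> \<eta>B)))"
    unfolding f_\<delta>[symmetric] by simp
  finally show ?thesis unfolding f_\<eta> D.PiR_w_def .
qed

section \<open>The maps between \<open>Q \<otimes> B\<close> and \<open>D\<close>\<close>

definition \<omega> where "\<omega> = \<mu>D \<bullet> (i \<otimes> f)"
definition \<omega>' where "\<omega>' = (p \<otimes> g) \<bullet> \<delta>D"
definition \<delta>Q where "\<delta>Q = (p \<otimes> p) \<bullet> \<delta>D \<bullet> i"
definition \<epsilon>Q where "\<epsilon>Q = \<epsilon>D \<bullet> i"

lemma \<omega>_hom: "\<omega> \<in> whom [Q, B] [D]" "\<omega>' \<in> whom [D] [Q, B]" "\<delta>Q \<in> whom [Q] [Q, Q]" "\<epsilon>Q \<in> whom [Q] []"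
  by (simp_all add: \<omega>_def \<omega>'_def \<delta>Q_def \<epsilon>Q_def)

lemmas \<omega>_hom_simps [simp] = \<omega>_hom whomD[OF \<omega>_hom(1)] whomD[OF \<omega>_hom(2)] whomD[OF \<omega>_hom(3)]
  whomD[OF \<omega>_hom(4)]

text \<open>The composite is \<open>d_1 f(S(g(d_2))) f(g(d_3))\<close>, that is
  \<open>d_1 f(PiR_w(g(d_2)))\<close> for the \<open>PiR_w\<close> of \<open>B\<close>;
  \<open>f_PiR_g\<close> and \<open>D.id_conv_PiR\<close> finish.\<close>

lemma \<omega>_\<omega>': "\<omega> \<bullet> \<omega>' = 1D"
proof -
  have "\<omega> \<bullet> \<omega>' = \<mu>D \<bullet> ((i \<bullet> p) \<otimes> (f \<bullet> g)) \<bullet> \<delta>D"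
    unfolding \<omega>_def \<omega>'_def by (rule diagram_eqI) simp_all
  also have "\<dots> = (\<mu>D \<bullet> (\<mu>D \<otimes> 1D)) \<bullet> (1D \<otimes> (f \<bullet> S \<bullet> g) \<otimes> (f \<bullet> g)) \<bullet> ((\<delta>D \<otimes> 1D) \<bullet> \<delta>D)"
    unfolding i_p by (rule diagram_eqI) simp_all
  also have "\<dots> = \<mu>D \<bullet> (1D \<otimes> ((\<mu>D \<bullet> (f \<otimes> f)) \<bullet> (S \<otimes> 1B) \<bullet> ((g \<otimes> g) \<bullet> \<delta>D))) \<bullet> \<delta>D"
    unfolding D.assoc D.coassoc by (rule diagram_eqI) simp_all
  also have "\<dots> = \<mu>D \<bullet> (1D \<otimes> (f \<bullet> (\<mu>B \<bullet> (S \<otimes> 1B) \<bullet> \<delta>B) \<bullet> g)) \<bullet> \<delta>D"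
    unfolding f_\<mu>[symmetric] g_\<delta>[symmetric] by (rule diagram_eqI) simp_all
  finally show ?thesis unfolding B.S_conv_id f_PiR_g D.id_conv_PiR .
qed

text \<open>Right \<open>B\<close>-linearity: \<open>p_\<delta>_\<mu>_f\<close> confines
  \<open>f(b)\<close> to the second leg, where \<open>g\<close> turns it into multiplication by
  \<open>b\<close>.\<close>

lemma \<omega>'_\<mu>_f: "\<omega>' \<bullet> \<mu>D \<bullet> (1D \<otimes> f) = (1Q \<otimes> \<mu>B) \<bullet> (\<omega>' \<otimes> 1B)"
proof -
  have "\<omega>' \<bullet> \<mu>D \<bullet> (1D \<otimes> f) = (1Q \<otimes> g) \<bullet> ((p \<otimes> 1D) \<bullet> \<delta>D \<bullet> \<mu>D \<bullet> (1D \<otimes> f))"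
    unfolding \<omega>'_def by (rule diagram_eqI) simp_all
  also have "\<dots> = (1Q \<otimes> (g \<bullet> \<mu>D \<bullet> (1D \<otimes> f))) \<bullet> (((p \<otimes> 1D) \<bullet> \<delta>D) \<otimes> 1B)"
    unfolding p_\<delta>_\<mu>_f by (rule diagram_eqI) simp_all
  also have "\<dots> = (1Q \<otimes> \<mu>B) \<bullet> (\<omega>' \<otimes> 1B)"
    unfolding g_\<mu>_f \<omega>'_def by (rule diagram_eqI) simp_all
  finally show ?thesis .
qed

text \<open>The second claim makes \<open>p\<close> comultiplicative, so the coalgebra laws of
  \<open>Q\<close> can be inherited from \<open>D\<close>; the first says that the left coaction of
  \<open>Q\<close> on \<open>D\<close> restricts along \<open>i\<close> to
  \<open>\<delta>Q\<close>.\<close>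

lemma p_\<delta>_i: "(p \<otimes> 1D) \<bullet> \<delta>D \<bullet> i = (1Q \<otimes> i) \<bullet> \<delta>Q"
  and p_p_\<delta>: "(p \<otimes> p) \<bullet> \<delta>D = \<delta>Q \<bullet> p"
proof -
  \<comment> \<open>Both claims come from colinearity of \<open>i \<bullet> p\<close>, which is
    \<open>p_\<delta>_\<mu>_f\<close> with \<open>S(g(d_2))\<close> in place of \<open>b\<close>,
    followed by coassociativity.\<close>
  have t: "(p \<otimes> 1D) \<bullet> \<delta>D \<bullet> (i \<bullet> p) = (p \<otimes> (i \<bullet> p)) \<bullet> \<delta>D"
  proof -
    have "(p \<otimes> 1D) \<bullet> \<delta>D \<bullet> (i \<bullet> p) = ((p \<otimes> 1D) \<bullet> \<delta>D \<bullet> \<mu>D \<bullet> (1D \<otimes> f)) \<bullet> (1D \<otimes> (S \<bullet> g)) \<bullet> \<delta>D"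
      unfolding i_p by (rule diagram_eqI) simp_all
    also have "\<dots> = (1Q \<otimes> \<mu>D) \<bullet> (p \<otimes> 1D \<otimes> (f \<bullet> S \<bullet> g)) \<bullet> ((\<delta>D \<otimes> 1D) \<bullet> \<delta>D)"
      unfolding p_\<delta>_\<mu>_f by (rule diagram_eqI) simp_all
    also have "\<dots> = (p \<otimes> (\<mu>D \<bullet> (1D \<otimes> (f \<bullet> S \<bullet> g)) \<bullet> \<delta>D)) \<bullet> \<delta>D"
      unfolding D.coassoc by (rule diagram_eqI) simp_all
    finally show ?thesis unfolding i_p .
  qed
  have "(p \<otimes> 1D) \<bullet> \<delta>D \<bullet> i = (p \<otimes> 1D) \<bullet> \<delta>D \<bullet> i \<bullet> (p \<bullet> i)" by (simp add: p_i)
  also have "\<dots> = ((p \<otimes> 1D) \<bullet> \<delta>D \<bullet> (i \<bullet> p)) \<bullet> i" by simp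
  also have "\<dots> = (1Q \<otimes> i) \<bullet> \<delta>Q"
    unfolding t \<delta>Q_def by (rule diagram_eqI) simp_all
  finally show "(p \<otimes> 1D) \<bullet> \<delta>D \<bullet> i = (1Q \<otimes> i) \<bullet> \<delta>Q" .
  have "\<delta>Q \<bullet> p = (1Q \<otimes> p) \<bullet> ((p \<otimes> 1D) \<bullet> \<delta>D \<bullet> (i \<bullet> p))"
    unfolding \<delta>Q_def by (rule diagram_eqI) simp_all
  also have "\<dots> = (p \<otimes> (p \<bullet> i \<bullet> p)) \<bullet> \<delta>D"
    unfolding t by (rule diagram_eqI) simp_all
  finally show "(p \<otimes> p) \<bullet> \<delta>D = \<delta>Q \<bullet> p" unfolding p_i_p ..
qed

lemma p_\<delta>_\<omega>: "(p \<otimes> 1D) \<bullet> \<delta>D \<bullet> \<omega> = (1Q \<otimes> \<omega>) \<bullet> (\<delta>Q \<otimes> 1B)"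
proof -
  have "(p \<otimes> 1D) \<bullet> \<delta>D \<bullet> \<omega> = ((p \<otimes> 1D) \<bullet> \<delta>D \<bullet> \<mu>D \<bullet> (1D \<otimes> f)) \<bullet> (i \<otimes> 1B)"
    unfolding \<omega>_def by (rule diagram_eqI) simp_all
  also have "\<dots> = (1Q \<otimes> \<mu>D) \<bullet> (((p \<otimes> 1D) \<bullet> \<delta>D \<bullet> i) \<otimes> f)"
    unfolding p_\<delta>_\<mu>_f by (rule diagram_eqI) simp_all
  also have "\<dots> = (1Q \<otimes> \<omega>) \<bullet> (\<delta>Q \<otimes> 1B)"
    unfolding p_\<delta>_i \<omega>_def by (rule diagram_eqI) simp_all
  finally show ?thesis .
qed

text \<open>Writing \<open>\<epsilon>D\<close> as \<open>\<epsilon>B \<bullet> g\<close> turns the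
  claim into \<open>\<epsilon>B(g(d)_1 S(g(d)_2)) = \<epsilon>B(g(d))\<close>, which is
  \<open>B.\<epsilon>_PiL\<close>.\<close>

lemma \<epsilon>Q_p: "\<epsilon>Q \<bullet> p = \<epsilon>D"
proof -
  have "\<epsilon>Q \<bullet> p = (\<epsilon>B \<bullet> g) \<bullet> \<mu>D \<bullet> (1D \<otimes> (f \<bullet> S \<bullet> g)) \<bullet> \<delta>D"
    unfolding g_\<epsilon> by (simp add: \<epsilon>Q_def i_p)
  also have "\<dots> = \<epsilon>B \<bullet> (g \<bullet> \<mu>D \<bullet> (1D \<otimes> f)) \<bullet> (1D \<otimes> (S \<bullet> g)) \<bullet> \<delta>D"
    by (rule diagram_eqI) simp_all
  also have "\<dots> = \<epsilon>B \<bullet> \<mu>B \<bullet> (1B \<otimes> S) \<bullet> ((g \<otimes> g) \<bullet> \<delta>D)"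
    unfolding g_\<mu>_f by (rule diagram_eqI) simp_all
  also have "\<dots> = (\<epsilon>B \<bullet> (\<mu>B \<bullet> (1B \<otimes> S) \<bullet> \<delta>B)) \<bullet> g"
    unfolding g_\<delta>[symmetric] by simp
  finally show ?thesis unfolding B.id_conv_S B.\<epsilon>_PiL g_\<epsilon> .
qed

section \<open>The weak crossed biproduct\<close>

definition \<psi> where "\<psi> = (p \<otimes> g) \<bullet> \<delta>D \<bullet> \<mu>D \<bullet> (f \<otimes> i)"
definition \<sigma> where "\<sigma> = (p \<otimes> g) \<bullet> \<delta>D \<bullet> \<mu>D \<bullet> (i \<otimes> i)"
definition \<chi> where "\<chi> = (g \<otimes> p) \<bullet> \<delta>D \<bullet> \<mu>D \<bullet> (i \<otimes> f)"
definition \<tau> where "\<tau> = (g \<otimes> g) \<bullet> \<delta>D \<bullet> \<mu>D \<bullet> (i \<otimes> f)"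
definition \<nu> where "\<nu> = (p \<otimes> g) \<bullet> \<delta>D \<bullet> \<eta>D"
definition \<upsilon> where "\<upsilon> = \<epsilon>D \<bullet> \<mu>D \<bullet> (i \<otimes> f)"

lemma biproduct_hom:
  "\<psi> \<in> whom [B, Q] [Q, B]" "\<sigma> \<in> whom [Q, Q] [Q, B]" "\<nu> \<in> whom [] [Q, B]"
  "\<chi> \<in> whom [Q, B] [B, Q]" "\<tau> \<in> whom [Q, B] [B, B]" "\<upsilon> \<in> whom [Q, B] []"
  by (simp_all add: \<psi>_def \<sigma>_def \<chi>_def \<tau>_def \<nu>_def \<upsilon>_def)

lemmas biproduct_hom_simps [simp] = biproduct_hom whomD[OF biproduct_hom(1)]
  whomD[OF biproduct_hom(2)] whomD[OF biproduct_hom(3)] whomD[OF biproduct_hom(4)]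
  whomD[OF biproduct_hom(5)] whomD[OF biproduct_hom(6)]

text \<open>The product-side morphisms end in \<open>\<omega>'\<close> and the coproduct-side ones
  start with \<open>\<omega>\<close>, so \<open>\<omega> \<bullet> \<omega>' = 1D\<close> cancels
  whenever they meet the opposite map.\<close>

lemma via_\<omega>:
  "\<psi> = \<omega>' \<bullet> \<mu>D \<bullet> (f \<otimes> i)" "\<sigma> = \<omega>' \<bullet> \<mu>D \<bullet> (i \<otimes> i)" "\<nu> = \<omega>' \<bullet> \<eta>D"
  "\<chi> = ((g \<otimes> p) \<bullet> \<delta>D) \<bullet> \<omega>" "\<tau> = ((g \<otimes> g) \<bullet> \<delta>D) \<bullet> \<omega>" "\<upsilon> = \<epsilon>D \<bullet> \<omega>"
  by (simp_all add: \<psi>_def \<sigma>_def \<chi>_def \<tau>_def \<nu>_def \<upsilon>_def \<omega>_def \<omega>'_def)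

lemma \<omega>_\<omega>'_comp: "valid a \<Longrightarrow> tgt a = [D] \<Longrightarrow> \<omega> \<bullet> \<omega>' \<bullet> a = a"
  using wcomp_assoc[of a \<omega>' \<omega>] by (simp add: \<omega>_\<omega>')

lemma \<omega>_cancel:
  "\<omega> \<bullet> \<psi> = \<mu>D \<bullet> (f \<otimes> i)" "\<omega> \<bullet> \<sigma> = \<mu>D \<bullet> (i \<otimes> i)" "\<omega> \<bullet> \<nu> = \<eta>D"
  by (simp_all add: via_\<omega> \<omega>_\<omega>'_comp)

lemma \<omega>'_cancel:
  "\<chi> \<bullet> \<omega>' = (g \<otimes> p) \<bullet> \<delta>D" "\<tau> \<bullet> \<omega>' = (g \<otimes> g) \<bullet> \<delta>D" "\<upsilon> \<bullet> \<omega>' = \<epsilon>D"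
  by (simp_all add: via_\<omega> \<omega>_\<omega>')

section \<open>The crossed product, from linearity of \<open>\<omega>'\<close>\<close>

lemma \<omega>'_act:
  assumes "valid a" "tgt a = [D]"
  shows "(1Q \<otimes> \<mu>B) \<bullet> ((\<omega>' \<bullet> a) \<otimes> 1B) = \<omega>' \<bullet> \<mu>D \<bullet> (a \<otimes> f)"
proof -
  \<comment> \<open>Once \<open>tgt a\<close> is rewritten to \<open>[D]\<close>, the assumption
    \<open>valid a\<close> no longer matches; this is its rewritten form.\<close>
  have [simp]: "a \<in> whom (src a) [D]"
    using assms by simp_all
  note [simp] = assms
  have "(1Q \<otimes> \<mu>B) \<bullet> ((\<omega>' \<bullet> a) \<otimes> 1B) = ((1Q \<otimes> \<mu>B) \<bullet> (\<omega>' \<otimes> 1B)) \<bullet> (a \<otimes> 1B)"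
    by (rule diagram_eqI) simp_all
  also have "\<dots> = \<omega>' \<bullet> \<mu>D \<bullet> (a \<otimes> f)"
    unfolding \<omega>'_\<mu>_f[symmetric] by (rule diagram_eqI) simp_all
  finally show ?thesis .
qed

lemma \<mu>_\<omega>:
  assumes "valid a" "tgt a = [D]"
  shows "\<mu>D \<bullet> ((\<mu>D \<bullet> (a \<otimes> i)) \<otimes> f) = \<mu>D \<bullet> (a \<otimes> \<omega>)"
proof -
  have [simp]: "a \<in> whom (src a) [D]"
    using assms by simp_all
  note [simp] = assms
  have "\<mu>D \<bullet> ((\<mu>D \<bullet> (a \<otimes> i)) \<otimes> f) = (\<mu>D \<bullet> (\<mu>D \<otimes> 1D)) \<bullet> (a \<otimes> i \<otimes> f)"
    by (rule diagram_eqI) simp_all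
  also have "\<dots> = \<mu>D \<bullet> (a \<otimes> \<omega>)"
    unfolding D.assoc \<omega>_def by (rule diagram_eqI) simp_all
  finally show ?thesis .
qed

text \<open>Linearity moves the multiplication by \<open>B\<close> under \<open>\<omega>'\<close>,
  where associativity of \<open>\<mu>D\<close> merges \<open>i\<close> and \<open>f\<close> into
  \<open>\<omega>\<close>.\<close>

lemma \<psi>_act: "(1Q \<otimes> \<mu>B) \<bullet> (\<psi> \<otimes> 1B) = \<omega>' \<bullet> \<mu>D \<bullet> (f \<otimes> \<omega>)"
  unfolding via_\<omega> by (subst \<omega>'_act) (simp_all add: \<mu>_\<omega>)

lemma \<sigma>_act: "(1Q \<otimes> \<mu>B) \<bullet> (\<sigma> \<otimes> 1B) = \<omega>' \<bullet> \<mu>D \<bullet> (i \<otimes> \<omega>)"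
  unfolding via_\<omega> by (subst \<omega>'_act) (simp_all add: \<mu>_\<omega>)

text \<open>Oriented to nest products to the left, so that the axioms below become comparisons of
  normalised products in \<open>D\<close>.\<close>

lemma \<mu>_assoc:
  assumes "valid a" "valid b" "valid c" "tgt a = [D]" "tgt b = [D]" "tgt c = [D]"
  shows "\<mu>D \<bullet> (a \<otimes> (\<mu>D \<bullet> (b \<otimes> c))) = \<mu>D \<bullet> ((\<mu>D \<bullet> (a \<otimes> b)) \<otimes> c)"
proof -
  have [simp]: "a \<in> whom (src a) [D]" "b \<in> whom (src b) [D]" "c \<in> whom (src c) [D]"
    using assms by simp_all
  note [simp] = assms
  have "\<mu>D \<bullet> (a \<otimes> (\<mu>D \<bullet> (b \<otimes> c))) = (\<mu>D \<bullet> (1D \<otimes> \<mu>D)) \<bullet> (a \<otimes> b \<otimes> c)"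
    by (rule diagram_eqI) simp_all
  also have "\<dots> = \<mu>D \<bullet> ((\<mu>D \<bullet> (a \<otimes> b)) \<otimes> c)"
    unfolding D.assoc[symmetric] by (rule diagram_eqI) simp_all
  finally show ?thesis .
qed

lemma \<psi>_\<mu>: "(1Q \<otimes> \<mu>B) \<bullet> (\<psi> \<otimes> 1B) \<bullet> (1B \<otimes> \<psi>) = \<psi> \<bullet> (\<mu>B \<otimes> 1Q)"
proof -
  have "(1Q \<otimes> \<mu>B) \<bullet> (\<psi> \<otimes> 1B) \<bullet> (1B \<otimes> \<psi>) = ((1Q \<otimes> \<mu>B) \<bullet> (\<psi> \<otimes> 1B)) \<bullet> (1B \<otimes> \<psi>)"
    by simp
  also have "\<dots> = \<omega>' \<bullet> \<mu>D \<bullet> (f \<otimes> (\<omega> \<bullet> \<psi>))"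
    unfolding \<psi>_act by (rule diagram_eqI) simp_all
  also have "\<dots> = \<omega>' \<bullet> \<mu>D \<bullet> ((f \<bullet> \<mu>B) \<otimes> i)"
    unfolding \<omega>_cancel f_\<mu> by (simp add: \<mu>_assoc)
  also have "\<dots> = \<psi> \<bullet> (\<mu>B \<otimes> 1Q)"
    unfolding via_\<omega> by (rule diagram_eqI) simp_all
  finally show ?thesis .
qed

lemma \<sigma>_\<psi>: "(1Q \<otimes> \<mu>B) \<bullet> (\<sigma> \<otimes> 1B) \<bullet> (1Q \<otimes> \<psi>) = \<omega>' \<bullet> \<mu>D \<bullet> (\<omega> \<otimes> i)"
proof -
  have "(1Q \<otimes> \<mu>B) \<bullet> (\<sigma> \<otimes> 1B) \<bullet> (1Q \<otimes> \<psi>) = ((1Q \<otimes> \<mu>B) \<bullet> (\<sigma> \<otimes> 1B)) \<bullet> (1Q \<otimes> \<psi>)"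
    by simp
  also have "\<dots> = \<omega>' \<bullet> \<mu>D \<bullet> (i \<otimes> (\<omega> \<bullet> \<psi>))"
    unfolding \<sigma>_act by (rule diagram_eqI) simp_all
  also have "\<dots> = \<omega>' \<bullet> \<mu>D \<bullet> (\<omega> \<otimes> i)"
    unfolding \<omega>_cancel by (simp add: \<mu>_assoc \<omega>_def)
  finally show ?thesis .
qed

lemma \<sigma>_\<psi>_comp:
  assumes "valid a" "tgt a = [Q, B]"
  shows "(1Q \<otimes> \<mu>B) \<bullet> (\<sigma> \<otimes> 1B) \<bullet> (1Q \<otimes> \<psi>) \<bullet> (a \<otimes> 1Q) = \<omega>' \<bullet> \<mu>D \<bullet> ((\<omega> \<bullet> a) \<otimes> i)"
proof -
  have [simp]: "a \<in> whom (src a) [Q, B]"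
    using assms by simp_all
  note [simp] = assms
  have "(1Q \<otimes> \<mu>B) \<bullet> (\<sigma> \<otimes> 1B) \<bullet> (1Q \<otimes> \<psi>) \<bullet> (a \<otimes> 1Q)
      = ((1Q \<otimes> \<mu>B) \<bullet> (\<sigma> \<otimes> 1B) \<bullet> (1Q \<otimes> \<psi>)) \<bullet> (a \<otimes> 1Q)" by simp
  also have "\<dots> = \<omega>' \<bullet> \<mu>D \<bullet> ((\<omega> \<bullet> a) \<otimes> i)"
    unfolding \<sigma>_\<psi> by (rule diagram_eqI) simp_all
  finally show ?thesis .
qed

lemma \<sigma>_comp:
  assumes "valid a" "tgt a = [Q, B]"
  shows "(1Q \<otimes> \<mu>B) \<bullet> (\<sigma> \<otimes> 1B) \<bullet> (1Q \<otimes> a) = \<omega>' \<bullet> \<mu>D \<bullet> (i \<otimes> (\<omega> \<bullet> a))"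
proof -
  have [simp]: "a \<in> whom (src a) [Q, B]"
    using assms by simp_all
  note [simp] = assms
  have "(1Q \<otimes> \<mu>B) \<bullet> (\<sigma> \<otimes> 1B) \<bullet> (1Q \<otimes> a)
      = ((1Q \<otimes> \<mu>B) \<bullet> (\<sigma> \<otimes> 1B)) \<bullet> (1Q \<otimes> a)" by simp
  also have "\<dots> = \<omega>' \<bullet> \<mu>D \<bullet> (i \<otimes> (\<omega> \<bullet> a))"
    unfolding \<sigma>_act by (rule diagram_eqI) simp_all
  finally show ?thesis .
qed

lemma \<psi>_comp:
  assumes "valid a" "tgt a = [Q, B]"
  shows "(1Q \<otimes> \<mu>B) \<bullet> (\<psi> \<otimes> 1B) \<bullet> (1B \<otimes> a) = \<omega>' \<bullet> \<mu>D \<bullet> (f \<otimes> (\<omega> \<bullet> a))"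
proof -
  have [simp]: "a \<in> whom (src a) [Q, B]"
    using assms by simp_all
  note [simp] = assms
  have "(1Q \<otimes> \<mu>B) \<bullet> (\<psi> \<otimes> 1B) \<bullet> (1B \<otimes> a)
      = ((1Q \<otimes> \<mu>B) \<bullet> (\<psi> \<otimes> 1B)) \<bullet> (1B \<otimes> a)" by simp
  also have "\<dots> = \<omega>' \<bullet> \<mu>D \<bullet> (f \<otimes> (\<omega> \<bullet> a))"
    unfolding \<psi>_act by (rule diagram_eqI) simp_all
  finally show ?thesis .
qed

text \<open>Both sides are \<open>\<omega>'\<close> applied to the triple product of
  \<open>f\<close>, \<open>i\<close>, \<open>i\<close>; for \<open>cocycle\<close> it is the triple
  product of \<open>i\<close>, \<open>i\<close>, \<open>i\<close>.\<close>

lemma twisted: "(1Q \<otimes> \<mu>B) \<bullet> (\<sigma> \<otimes> 1B) \<bullet> (1Q \<otimes> \<psi>) \<bullet> (\<psi> \<otimes> 1Q)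
    = (1Q \<otimes> \<mu>B) \<bullet> (\<psi> \<otimes> 1B) \<bullet> (1B \<otimes> \<sigma>)"
  by (simp add: \<sigma>_\<psi>_comp \<psi>_comp \<omega>_cancel \<mu>_assoc)

lemma cocycle: "(1Q \<otimes> \<mu>B) \<bullet> (\<sigma> \<otimes> 1B) \<bullet> (1Q \<otimes> \<sigma>)
    = (1Q \<otimes> \<mu>B) \<bullet> (\<sigma> \<otimes> 1B) \<bullet> (1Q \<otimes> \<psi>) \<bullet> (\<sigma> \<otimes> 1Q)"
  by (simp add: \<sigma>_\<psi>_comp \<sigma>_comp \<omega>_cancel \<mu>_assoc)

lemma \<mu>_unit:
  assumes "valid a" "tgt a = [D]"
  shows "\<mu>D \<bullet> (\<eta>D \<otimes> a) = a" "\<mu>D \<bullet> (a \<otimes> \<eta>D) = a"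
proof -
  have [simp]: "a \<in> whom (src a) [D]"
    using assms by simp_all
  note [simp] = assms
  have "\<mu>D \<bullet> (\<eta>D \<otimes> a) = (\<mu>D \<bullet> (\<eta>D \<otimes> 1D)) \<bullet> a" "\<mu>D \<bullet> (a \<otimes> \<eta>D) = (\<mu>D \<bullet> (1D \<otimes> \<eta>D)) \<bullet> a"
    by (rule diagram_eqI; simp)+
  then show "\<mu>D \<bullet> (\<eta>D \<otimes> a) = a" "\<mu>D \<bullet> (a \<otimes> \<eta>D) = a"
    by (simp_all add: D.unit_left D.unit_right)
qed

text \<open>This and the next four definitions are word-typed copies of the constants of the crossed
  (co)product; the lemmas \<open>mor_\<beta>\<close> to \<open>mor_\<delta>x\<close> identify
  them.\<close>

definition \<beta> where "\<beta> = (1Q \<otimes> \<mu>B) \<bullet> (\<nu> \<otimes> 1B)"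
definition nab where "nab = (1Q \<otimes> \<mu>B) \<bullet> ((\<psi> \<bullet> (\<eta>B \<otimes> 1Q)) \<otimes> 1B)"
definition \<Gamma> where "\<Gamma> = (1Q \<otimes> 1B \<otimes> \<epsilon>Q) \<bullet> (1Q \<otimes> \<chi>) \<bullet> (\<delta>Q \<otimes> 1B)"
definition \<mu>x where "\<mu>x = (1Q \<otimes> \<mu>B) \<bullet> (\<sigma> \<otimes> \<mu>B) \<bullet> (1Q \<otimes> \<psi> \<otimes> 1B)"
definition \<delta>x where "\<delta>x = (1Q \<otimes> \<chi> \<otimes> 1B) \<bullet> (\<delta>Q \<otimes> \<tau>) \<bullet> (\<delta>Q \<otimes> 1B)"

lemma \<beta>_eq: "\<beta> = \<omega>' \<bullet> f"
  unfolding \<beta>_def via_\<omega> by (simp add: \<omega>'_act \<mu>_unit)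

text \<open>Unitality of \<open>f\<close> gives \<open>\<psi>(1, q) = \<omega>'(i(q))\<close>, and
  linearity then produces \<open>\<omega>'(i(q) f(b))\<close>.\<close>

lemma nab_eq: "nab = \<omega>' \<bullet> \<omega>"
proof -
  have "\<psi> \<bullet> (\<eta>B \<otimes> 1Q) = \<omega>' \<bullet> \<mu>D \<bullet> ((f \<bullet> \<eta>B) \<otimes> i)"
    unfolding via_\<omega> by (rule diagram_eqI) simp_all
  then have "\<psi> \<bullet> (\<eta>B \<otimes> 1Q) = \<omega>' \<bullet> i"
    by (simp add: f_\<eta> \<mu>_unit)
  then show ?thesis
    unfolding nab_def by (simp add: \<omega>'_act \<omega>_def)
qed

lemma nab_\<sigma>: "nab \<bullet> \<sigma> = \<sigma>"
  unfolding nab_eq by (simp add: \<omega>_cancel) (simp add: via_\<omega>)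

lemma nab_\<eta>: "nab \<bullet> (1Q \<otimes> \<eta>B) = \<omega>' \<bullet> i"
proof -
  have "nab \<bullet> (1Q \<otimes> \<eta>B) = \<omega>' \<bullet> \<mu>D \<bullet> (i \<otimes> (f \<bullet> \<eta>B))"
    unfolding nab_eq \<omega>_def by (rule diagram_eqI) simp_all
  then show ?thesis by (simp add: f_\<eta> \<mu>_unit)
qed

text \<open>Since \<open>\<omega> \<bullet> \<nu> = \<eta>D\<close>, these are unit laws of
  \<open>D\<close>: the first two sides collapse to \<open>\<omega>' \<bullet> i\<close>, the third
  to \<open>\<omega>' \<bullet> f\<close>.\<close>

lemma preunit:
  "(1Q \<otimes> \<mu>B) \<bullet> (\<sigma> \<otimes> 1B) \<bullet> (1Q \<otimes> \<psi>) \<bullet> (\<nu> \<otimes> 1Q) = nab \<bullet> (1Q \<otimes> \<eta>B)"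
  "(1Q \<otimes> \<mu>B) \<bullet> (\<sigma> \<otimes> 1B) \<bullet> (1Q \<otimes> \<nu>) = nab \<bullet> (1Q \<otimes> \<eta>B)"
  "(1Q \<otimes> \<mu>B) \<bullet> (\<psi> \<otimes> 1B) \<bullet> (1B \<otimes> \<nu>) = \<beta>"
  by (simp_all add: \<sigma>_\<psi>_comp \<sigma>_comp \<psi>_comp nab_\<eta> \<omega>_cancel \<mu>_unit \<beta>_eq)

lemma \<mu>x_eq: "\<mu>x = \<omega>' \<bullet> \<mu>D \<bullet> (\<omega> \<otimes> \<omega>)"
proof -
  \<comment> \<open>Reassociating the two products of \<open>B\<close> isolates the block computed
    in \<open>\<sigma>_\<psi>\<close>.\<close>
  have "\<mu>x = (1Q \<otimes> (\<mu>B \<bullet> (1B \<otimes> \<mu>B))) \<bullet> (\<sigma> \<otimes> 1B \<otimes> 1B) \<bullet> (1Q \<otimes> \<psi> \<otimes> 1B)"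
    unfolding \<mu>x_def by (rule diagram_eqI) simp_all
  also have "\<dots> = (1Q \<otimes> \<mu>B) \<bullet> (((1Q \<otimes> \<mu>B) \<bullet> (\<sigma> \<otimes> 1B) \<bullet> (1Q \<otimes> \<psi>)) \<otimes> 1B)"
    unfolding B.assoc[symmetric] by (rule diagram_eqI) simp_all
  also have "\<dots> = \<omega>' \<bullet> \<mu>D \<bullet> (\<omega> \<otimes> \<omega>)"
    unfolding \<sigma>_\<psi> by (simp add: \<omega>'_act \<mu>_\<omega>)
  finally show ?thesis .
qed

section \<open>The crossed coproduct, from colinearity of \<open>\<omega>\<close>\<close>

lemma \<omega>_coact:
  assumes "valid a" "src a = [D]"
  shows "(1Q \<otimes> (a \<bullet> \<omega>)) \<bullet> (\<delta>Q \<otimes> 1B) = (p \<otimes> a) \<bullet> \<delta>D \<bullet> \<omega>"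
proof -
  have [simp]: "a \<in> whom [D] (tgt a)"
    using assms by simp_all
  note [simp] = assms
  have "(1Q \<otimes> (a \<bullet> \<omega>)) \<bullet> (\<delta>Q \<otimes> 1B) = (1Q \<otimes> a) \<bullet> ((1Q \<otimes> \<omega>) \<bullet> (\<delta>Q \<otimes> 1B))"
    by (rule diagram_eqI) simp_all
  also have "\<dots> = (p \<otimes> a) \<bullet> \<delta>D \<bullet> \<omega>"
    unfolding p_\<delta>_\<omega>[symmetric] by (rule diagram_eqI) simp_all
  finally show ?thesis .
qed

text \<open>Coassociativity for arbitrary legs \<open>a\<close>, \<open>b\<close>, \<open>c\<close>,
  oriented so that iterated coproducts nest to the left.\<close>

lemma \<delta>_coassoc:
  assumes "valid a" "valid b" "valid c" "valid r" "src a = [D]" "src b = [D]" "src c = [D]" "tgt r = [D]"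
  shows "(a \<otimes> ((b \<otimes> c) \<bullet> \<delta>D)) \<bullet> \<delta>D \<bullet> r = (((a \<otimes> b) \<bullet> \<delta>D) \<otimes> c) \<bullet> \<delta>D \<bullet> r"
proof -
  have [simp]: "a \<in> whom [D] (tgt a)" "b \<in> whom [D] (tgt b)" "c \<in> whom [D] (tgt c)" "r \<in> whom (src r) [D]"
    using assms by simp_all
  note [simp] = assms
  have "(a \<otimes> ((b \<otimes> c) \<bullet> \<delta>D)) \<bullet> \<delta>D \<bullet> r = (a \<otimes> b \<otimes> c) \<bullet> ((1D \<otimes> \<delta>D) \<bullet> \<delta>D) \<bullet> r"
    by (rule diagram_eqI) simp_all
  also have "\<dots> = (((a \<otimes> b) \<bullet> \<delta>D) \<otimes> c) \<bullet> \<delta>D \<bullet> r"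
    unfolding D.coassoc[symmetric] by (rule diagram_eqI) simp_all
  finally show ?thesis .
qed

text \<open>Colinearity exposes an iterated coproduct with legs \<open>p\<close>, \<open>g\<close>,
  \<open>p\<close>, and its first two legs form \<open>\<omega>'\<close>.\<close>

lemma \<chi>_coact: "(1Q \<otimes> \<chi>) \<bullet> (\<delta>Q \<otimes> 1B) = (\<omega>' \<otimes> p) \<bullet> \<delta>D \<bullet> \<omega>"
  unfolding via_\<omega> by (subst \<omega>_coact) (simp_all add: \<delta>_coassoc \<omega>'_def)

lemma \<tau>_coact: "(1Q \<otimes> \<tau>) \<bullet> (\<delta>Q \<otimes> 1B) = (\<omega>' \<otimes> g) \<bullet> \<delta>D \<bullet> \<omega>"
  unfolding via_\<omega> by (subst \<omega>_coact) (simp_all add: \<delta>_coassoc \<omega>'_def)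

lemma \<omega>'_comp:
  assumes "valid a" "valid c" "src a = [Q, B]" "src c = [D]"
  shows "(a \<otimes> wid (tgt c)) \<bullet> (\<omega>' \<otimes> c) \<bullet> \<delta>D \<bullet> \<omega> = ((a \<bullet> \<omega>') \<otimes> c) \<bullet> \<delta>D \<bullet> \<omega>"
    "(wid (tgt c) \<otimes> a) \<bullet> (c \<otimes> \<omega>') \<bullet> \<delta>D \<bullet> \<omega> = (c \<otimes> (a \<bullet> \<omega>')) \<bullet> \<delta>D \<bullet> \<omega>"
proof -
  have [simp]: "a \<in> whom [Q, B] (tgt a)" "c \<in> whom [D] (tgt c)"
    using assms by simp_all
  note [simp] = assms
  show "(a \<otimes> wid (tgt c)) \<bullet> (\<omega>' \<otimes> c) \<bullet> \<delta>D \<bullet> \<omega> = ((a \<bullet> \<omega>') \<otimes> c) \<bullet> \<delta>D \<bullet> \<omega>"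
    by (rule diagram_eqI) simp_all
  show "(wid (tgt c) \<otimes> a) \<bullet> (c \<otimes> \<omega>') \<bullet> \<delta>D \<bullet> \<omega> = (c \<otimes> (a \<bullet> \<omega>')) \<bullet> \<delta>D \<bullet> \<omega>"
    by (rule diagram_eqI) simp_all
qed

lemma \<delta>_counit:
  assumes "valid c" "valid r" "src c = [D]" "tgt r = [D]"
  shows "(\<epsilon>D \<otimes> c) \<bullet> \<delta>D \<bullet> r = c \<bullet> r" "(c \<otimes> \<epsilon>D) \<bullet> \<delta>D \<bullet> r = c \<bullet> r"
proof -
  have [simp]: "r \<in> whom (src r) [D]" "c \<in> whom [D] (tgt c)"
    using assms by simp_all
  note [simp] = assms
  have "(\<epsilon>D \<otimes> c) \<bullet> \<delta>D \<bullet> r = c \<bullet> ((\<epsilon>D \<otimes> 1D) \<bullet> \<delta>D) \<bullet> r"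
    by (rule diagram_eqI) simp_all
  then show "(\<epsilon>D \<otimes> c) \<bullet> \<delta>D \<bullet> r = c \<bullet> r"
    by (simp add: D.counit_left)
  have "(c \<otimes> \<epsilon>D) \<bullet> \<delta>D \<bullet> r = c \<bullet> ((1D \<otimes> \<epsilon>D) \<bullet> \<delta>D) \<bullet> r"
    by (rule diagram_eqI) simp_all
  then show "(c \<otimes> \<epsilon>D) \<bullet> \<delta>D \<bullet> r = c \<bullet> r"
    by (simp add: D.counit_right)
qed

text \<open>As \<open>\<epsilon>Q \<bullet> p\<close> is the counit of \<open>D\<close>, discarding
  the \<open>Q\<close> leg of \<open>\<omega>'\<close> leaves \<open>g\<close>.\<close>

lemma \<epsilon>Q_\<omega>':
  assumes "valid r" "tgt r = [D]"
  shows "(\<epsilon>Q \<otimes> 1B) \<bullet> \<omega>' \<bullet> r = g \<bullet> r"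
proof -
  have [simp]: "r \<in> whom (src r) [D]"
    using assms by simp
  note [simp] = assms
  have "(\<epsilon>Q \<otimes> 1B) \<bullet> \<omega>' \<bullet> r = ((\<epsilon>Q \<bullet> p) \<otimes> g) \<bullet> \<delta>D \<bullet> r"
    unfolding \<omega>'_def by (rule diagram_eqI) simp_all
  then show ?thesis by (simp add: \<epsilon>Q_p \<delta>_counit)
qed

lemma Q_counit: "(\<epsilon>Q \<otimes> 1Q) \<bullet> \<delta>Q = 1Q" "(1Q \<otimes> \<epsilon>Q) \<bullet> \<delta>Q = 1Q"
proof -
  have "(\<epsilon>Q \<otimes> 1Q) \<bullet> \<delta>Q = ((\<epsilon>Q \<bullet> p) \<otimes> p) \<bullet> \<delta>D \<bullet> i"
    "(1Q \<otimes> \<epsilon>Q) \<bullet> \<delta>Q = (p \<otimes> (\<epsilon>Q \<bullet> p)) \<bullet> \<delta>D \<bullet> i"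
    unfolding \<delta>Q_def by (rule diagram_eqI; simp)+
  then show "(\<epsilon>Q \<otimes> 1Q) \<bullet> \<delta>Q = 1Q" "(1Q \<otimes> \<epsilon>Q) \<bullet> \<delta>Q = 1Q"
    by (simp_all add: \<epsilon>Q_p \<delta>_counit p_i)
qed

text \<open>Both sides are the iterated coproduct of \<open>D\<close> after \<open>i\<close> with
  all three legs \<open>p\<close>, because \<open>p\<close> is comultiplicative.\<close>

lemma Q_coassoc: "(\<delta>Q \<otimes> 1Q) \<bullet> \<delta>Q = (1Q \<otimes> \<delta>Q) \<bullet> \<delta>Q"
proof -
  have "(\<delta>Q \<otimes> 1Q) \<bullet> ((p \<otimes> p) \<bullet> \<delta>D \<bullet> i) = ((\<delta>Q \<bullet> p) \<otimes> p) \<bullet> \<delta>D \<bullet> i"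
    by (rule diagram_eqI) simp_all
  also have "\<dots> = (p \<otimes> (\<delta>Q \<bullet> p)) \<bullet> \<delta>D \<bullet> i"
    by (simp add: p_p_\<delta>[symmetric] \<delta>_coassoc)
  also have "\<dots> = (1Q \<otimes> \<delta>Q) \<bullet> ((p \<otimes> p) \<bullet> \<delta>D \<bullet> i)"
    by (rule diagram_eqI) simp_all
  finally show ?thesis unfolding \<delta>Q_def[symmetric] .
qed

text \<open>The third leg in \<open>\<chi>_coact\<close> is \<open>p\<close>, and
  \<open>\<epsilon>Q \<bullet> p = \<epsilon>D\<close> removes it.\<close>

lemma \<Gamma>_eq: "\<Gamma> = \<omega>' \<bullet> \<omega>"
proof -
  have "\<Gamma> = (1Q \<otimes> 1B \<otimes> \<epsilon>Q) \<bullet> ((\<omega>' \<otimes> p) \<bullet> \<delta>D \<bullet> \<omega>)"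
    unfolding \<Gamma>_def \<chi>_coact ..
  also have "\<dots> = (\<omega>' \<otimes> (\<epsilon>Q \<bullet> p)) \<bullet> \<delta>D \<bullet> \<omega>"
    by (rule diagram_eqI) simp_all
  finally show ?thesis by (simp add: \<epsilon>Q_p \<delta>_counit)
qed

lemma \<tau>_\<Gamma>: "\<tau> \<bullet> \<Gamma> = \<tau>"
  by (simp add: \<Gamma>_eq via_\<omega> \<omega>_\<omega>'_comp)

lemma \<epsilon>Q_\<Gamma>: "(\<epsilon>Q \<otimes> 1B) \<bullet> \<Gamma> = g \<bullet> \<omega>"
  unfolding \<Gamma>_eq by (simp add: \<epsilon>Q_\<omega>')

lemma \<chi>_\<delta>: "(\<chi> \<otimes> 1Q) \<bullet> (1Q \<otimes> \<chi>) \<bullet> (\<delta>Q \<otimes> 1B) = (1B \<otimes> \<delta>Q) \<bullet> \<chi>"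
proof -
  have "(1B \<otimes> \<delta>Q) \<bullet> \<chi> = (g \<otimes> (\<delta>Q \<bullet> p)) \<bullet> \<delta>D \<bullet> \<omega>"
    unfolding via_\<omega> by (rule diagram_eqI) simp_all
  also have "\<dots> = (((g \<otimes> p) \<bullet> \<delta>D) \<otimes> p) \<bullet> \<delta>D \<bullet> \<omega>"
    by (simp add: p_p_\<delta>[symmetric] \<delta>_coassoc)
  finally show ?thesis
    using \<omega>'_comp(1)[of \<chi> p] by (simp add: \<chi>_coact \<omega>'_cancel)
qed

text \<open>This block recurs in the twisted, cocycle and precounit conditions and in the coproduct
  \<open>\<delta>x\<close>.\<close>

lemma \<chi>_\<tau>: "(\<chi> \<otimes> 1B) \<bullet> (1Q \<otimes> \<tau>) \<bullet> (\<delta>Q \<otimes> 1B) = (g \<otimes> \<omega>') \<bullet> \<delta>D \<bullet> \<omega>"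
proof -
  have "(\<chi> \<otimes> 1B) \<bullet> (1Q \<otimes> \<tau>) \<bullet> (\<delta>Q \<otimes> 1B) = (g \<otimes> ((p \<otimes> g) \<bullet> \<delta>D)) \<bullet> \<delta>D \<bullet> \<omega>"
    using \<omega>'_comp(1)[of \<chi> g] by (simp add: \<tau>_coact \<omega>'_cancel \<delta>_coassoc)
  then show ?thesis unfolding \<omega>'_def[symmetric] .
qed

text \<open>Both sides are the iterated coproduct after \<open>\<omega>\<close> with legs
  \<open>g\<close>, \<open>g\<close>, \<open>p\<close>; in \<open>co_cocycle\<close> the legs are
  \<open>g\<close>, \<open>g\<close>, \<open>g\<close>.\<close>

lemma co_twisted: "(\<tau> \<otimes> 1Q) \<bullet> (1Q \<otimes> \<chi>) \<bullet> (\<delta>Q \<otimes> 1B)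
    = (1B \<otimes> \<chi>) \<bullet> (\<chi> \<otimes> 1B) \<bullet> (1Q \<otimes> \<tau>) \<bullet> (\<delta>Q \<otimes> 1B)"
  unfolding \<chi>_\<tau> \<chi>_coact using \<omega>'_comp(1)[of \<tau> p] \<omega>'_comp(2)[of \<chi> g]
  by (simp add: \<omega>'_cancel \<delta>_coassoc)

lemma co_cocycle: "(\<tau> \<otimes> 1B) \<bullet> (1Q \<otimes> \<tau>) \<bullet> (\<delta>Q \<otimes> 1B)
    = (1B \<otimes> \<tau>) \<bullet> (\<chi> \<otimes> 1B) \<bullet> (1Q \<otimes> \<tau>) \<bullet> (\<delta>Q \<otimes> 1B)"
  \<comment> \<open>The order matters: the left side of \<open>\<tau>_coact\<close> occurs inside
    that of \<open>\<chi>_\<tau>\<close>.\<close>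
  unfolding \<chi>_\<tau> unfolding \<tau>_coact using \<omega>'_comp(1)[of \<tau> g] \<omega>'_comp(2)[of \<tau> g]
  by (simp add: \<omega>'_cancel \<delta>_coassoc)

definition \<gamma> where "\<gamma> = (1Q \<otimes> \<upsilon>) \<bullet> (\<delta>Q \<otimes> 1B)"

text \<open>On \<open>\<omega>'\<close> the precounit is \<open>\<epsilon>D\<close>, so these are
  counit laws of \<open>D\<close>: the first two sides collapse to
  \<open>g \<bullet> \<omega>\<close>, the third to \<open>p \<bullet> \<omega>\<close>.\<close>

lemma precounit:
  "(1B \<otimes> \<upsilon>) \<bullet> (\<chi> \<otimes> 1B) \<bullet> (1Q \<otimes> \<tau>) \<bullet> (\<delta>Q \<otimes> 1B) = (\<epsilon>Q \<otimes> 1B) \<bullet> \<Gamma>"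
  "(\<upsilon> \<otimes> 1B) \<bullet> (1Q \<otimes> \<tau>) \<bullet> (\<delta>Q \<otimes> 1B) = (\<epsilon>Q \<otimes> 1B) \<bullet> \<Gamma>"
  "(\<upsilon> \<otimes> 1Q) \<bullet> (1Q \<otimes> \<chi>) \<bullet> (\<delta>Q \<otimes> 1B) = \<gamma>"
proof -
  show "(1B \<otimes> \<upsilon>) \<bullet> (\<chi> \<otimes> 1B) \<bullet> (1Q \<otimes> \<tau>) \<bullet> (\<delta>Q \<otimes> 1B) = (\<epsilon>Q \<otimes> 1B) \<bullet> \<Gamma>"
    unfolding \<chi>_\<tau> \<epsilon>Q_\<Gamma> using \<omega>'_comp(2)[of \<upsilon> g] by (simp add: \<omega>'_cancel \<delta>_counit)
  show "(\<upsilon> \<otimes> 1B) \<bullet> (1Q \<otimes> \<tau>) \<bullet> (\<delta>Q \<otimes> 1B) = (\<epsilon>Q \<otimes> 1B) \<bullet> \<Gamma>"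
    unfolding \<tau>_coact \<epsilon>Q_\<Gamma> using \<omega>'_comp(1)[of \<upsilon> g] by (simp add: \<omega>'_cancel \<delta>_counit)
  have "\<gamma> = p \<bullet> \<omega>"
    unfolding \<gamma>_def via_\<omega> by (simp add: \<omega>_coact \<delta>_counit)
  then show "(\<upsilon> \<otimes> 1Q) \<bullet> (1Q \<otimes> \<chi>) \<bullet> (\<delta>Q \<otimes> 1B) = \<gamma>"
    unfolding \<chi>_coact using \<omega>'_comp(1)[of \<upsilon> p] by (simp add: \<omega>'_cancel \<delta>_counit)
qed

lemma \<delta>x_eq: "\<delta>x = (\<omega>' \<otimes> \<omega>') \<bullet> \<delta>D \<bullet> \<omega>"
proof -
  have "\<delta>x = (1Q \<otimes> \<chi> \<otimes> 1B) \<bullet> (1Q \<otimes> 1Q \<otimes> \<tau>) \<bullet> (((\<delta>Q \<otimes> 1Q) \<bullet> \<delta>Q) \<otimes> 1B)"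
    unfolding \<delta>x_def by (rule diagram_eqI) simp_all
  \<comment> \<open>Coassociativity of \<open>\<delta>Q\<close> regroups the strands so that the
    block of \<open>\<chi>_\<tau>\<close> appears.\<close>
  also have "\<dots> = (1Q \<otimes> ((\<chi> \<otimes> 1B) \<bullet> (1Q \<otimes> \<tau>) \<bullet> (\<delta>Q \<otimes> 1B))) \<bullet> (\<delta>Q \<otimes> 1B)"
    unfolding Q_coassoc by (rule diagram_eqI) simp_all
  also have "\<dots> = (1Q \<otimes> (((g \<otimes> \<omega>') \<bullet> \<delta>D) \<bullet> \<omega>)) \<bullet> (\<delta>Q \<otimes> 1B)"
    unfolding \<chi>_\<tau> by simp
  also have "\<dots> = (p \<otimes> ((g \<otimes> \<omega>') \<bullet> \<delta>D)) \<bullet> \<delta>D \<bullet> \<omega>"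
    by (rule \<omega>_coact) simp_all
  also have "\<dots> = (((p \<otimes> g) \<bullet> \<delta>D) \<otimes> \<omega>') \<bullet> \<delta>D \<bullet> \<omega>"
    by (rule \<delta>_coassoc) simp_all
  finally show ?thesis unfolding \<omega>'_def[symmetric] .
qed

lemma nab_\<Gamma>: "nab = \<Gamma>"
  unfolding nab_eq \<Gamma>_eq ..

lemma \<epsilon>Q_\<nu>: "(\<epsilon>Q \<otimes> 1B) \<bullet> \<nu> = \<eta>B"
proof -
  have "(\<epsilon>Q \<otimes> 1B) \<bullet> \<nu> = (g \<bullet> f) \<bullet> \<eta>B"
    unfolding via_\<omega> by (simp add: \<epsilon>Q_\<omega>' f_\<eta>)
  then show ?thesis by (simp add: g_f)
qed

lemma \<upsilon>_\<eta>: "\<upsilon> \<bullet> (1Q \<otimes> \<eta>B) = \<epsilon>Q"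
proof -
  have "\<upsilon> \<bullet> (1Q \<otimes> \<eta>B) = \<epsilon>D \<bullet> \<mu>D \<bullet> (i \<otimes> (f \<bullet> \<eta>B))"
    unfolding \<upsilon>_def by (rule diagram_eqI) simp_all
  then show ?thesis by (simp add: f_\<eta> \<mu>_unit \<epsilon>Q_def)
qed

text \<open>As \<open>\<beta> = \<omega>' \<bullet> f\<close> and \<open>\<omega>\<close> cancels
  \<open>\<omega>'\<close>, this is comultiplicativity of \<open>f\<close>.\<close>

lemma \<delta>x_\<beta>: "\<delta>x \<bullet> \<beta> = (\<beta> \<otimes> \<beta>) \<bullet> \<delta>B"
proof -
  have "\<delta>x \<bullet> \<beta> = (\<omega>' \<otimes> \<omega>') \<bullet> (\<delta>D \<bullet> f)"
    unfolding \<delta>x_eq \<beta>_eq by (simp add: \<omega>_\<omega>'_comp)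
  also have "\<dots> = (\<beta> \<otimes> \<beta>) \<bullet> \<delta>B"
    unfolding f_\<delta> \<beta>_eq by (rule diagram_eqI) simp_all
  finally show ?thesis .
qed

text \<open>Applying \<open>\<epsilon>Q\<close> reduces \<open>nab\<close> to
  \<open>g \<bullet> \<omega>\<close>, and \<open>g\<close> is comultiplicative.\<close>

lemma \<tau>_eq_nab: "\<tau> = (\<epsilon>Q \<otimes> \<delta>B) \<bullet> nab"
proof -
  have "(\<epsilon>Q \<otimes> \<delta>B) \<bullet> nab = \<delta>B \<bullet> ((\<epsilon>Q \<otimes> 1B) \<bullet> \<omega>' \<bullet> \<omega>)"
    unfolding nab_eq by (rule diagram_eqI) simp_all
  also have "\<dots> = (\<delta>B \<bullet> g) \<bullet> \<omega>" by (simp add: \<epsilon>Q_\<omega>')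
  finally show ?thesis by (simp add: g_\<delta> via_\<omega>)
qed

lemma \<upsilon>_eq_nab: "\<upsilon> = (\<epsilon>Q \<otimes> \<epsilon>B) \<bullet> nab"
proof -
  have "(\<epsilon>Q \<otimes> \<epsilon>B) \<bullet> nab = \<epsilon>B \<bullet> ((\<epsilon>Q \<otimes> 1B) \<bullet> \<omega>' \<bullet> \<omega>)"
    unfolding nab_eq by (rule diagram_eqI) simp_all
  also have "\<dots> = (\<epsilon>B \<bullet> g) \<bullet> \<omega>" by (simp add: \<epsilon>Q_\<omega>')
  finally show ?thesis by (simp add: g_\<epsilon> via_\<omega>)
qed

section \<open>Translation back to arrows of the category\<close>

lemma mor_\<beta>: "mor \<beta> = beta_nu C Q B (mor \<mu>B) (mor \<nu>)"
  by (simp add: \<beta>_def beta_nu_def tobj_unit)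

lemma mor_nab: "mor nab = nabla C Q B (mor \<eta>B) (mor \<mu>B) (mor \<psi>)"
  by (simp add: nab_def nabla_def tobj_unit)

lemma mor_\<Gamma>: "mor \<Gamma> = Gamma C Q B (mor \<epsilon>Q) (mor \<delta>Q) (mor \<chi>)"
  unfolding \<Gamma>_def Gamma_def mor_simps by (simp add: tobj_unit)

lemma mor_\<gamma>: "mor \<gamma> = gamma_upsilon C Q B (mor \<delta>Q) (mor \<upsilon>)"
  by (simp add: \<gamma>_def gamma_upsilon_def tobj_unit)

lemma mor_\<mu>x: "mor \<mu>x = mu_cp C Q B (mor \<mu>B) (mor \<psi>) (mor \<sigma>)"
  by (simp add: \<mu>x_def mu_cp_def tobj_unit)

lemma mor_\<delta>x: "mor \<delta>x = delta_cp C Q B (mor \<delta>Q) (mor \<chi>) (mor \<tau>)"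
  by (simp add: \<delta>x_def delta_cp_def tobj_unit)

lemmas mor_cp = mor_\<beta>[symmetric] mor_nab[symmetric] mor_\<Gamma>[symmetric] mor_\<gamma>[symmetric]
  mor_\<mu>x[symmetric] mor_\<delta>x[symmetric]

lemma words: "word [B] = B" "word [Q] = Q" "word [D] = D"
  by (simp_all add: tobj_unit)

lemma algebra_B: "algebra C B (mor \<eta>B) (mor \<mu>B)"
  using whomD(4)[OF B.\<eta>_hom] whomD(4)[OF B.\<mu>_hom]
    B.unit_left[THEN arg_cong[of _ _ mor]] B.unit_right[THEN arg_cong[of _ _ mor]]
    B.assoc[THEN arg_cong[of _ _ mor]]
  unfolding mor_simps words algebra_def by (simp add: tobj_unit)

lemma coalgebra_Q: "coalgebra C Q (mor \<epsilon>Q) (mor \<delta>Q)"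
  using whomD(4)[OF \<omega>_hom(3)] whomD(4)[OF \<omega>_hom(4)]
    Q_counit[THEN arg_cong[of _ _ mor]] Q_coassoc[THEN arg_cong[of _ _ mor]]
  unfolding mor_simps words coalgebra_def by (simp add: tobj_unit)

lemma crossed_product:
  "weak_crossed_product_preunit C Q B (mor \<eta>B) (mor \<mu>B) (mor \<psi>) (mor \<sigma>) (mor \<nu>)"
  using algebra_B biproduct_hom(1-3)[THEN whomD(4)]
    \<psi>_\<mu>[THEN arg_cong[of _ _ mor]] nab_\<sigma>[THEN arg_cong[of _ _ mor]]
    twisted[THEN arg_cong[of _ _ mor]] cocycle[THEN arg_cong[of _ _ mor]]
    preunit[THEN arg_cong[of _ _ mor]]
  unfolding mor_simps words weak_crossed_product_preunit_def mor_cp by (simp add: tobj_unit)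

lemma crossed_coproduct:
  "weak_crossed_coproduct_precounit C Q B (mor \<epsilon>Q) (mor \<delta>Q) (mor \<chi>) (mor \<tau>) (mor \<upsilon>)"
  using coalgebra_Q biproduct_hom(4-6)[THEN whomD(4)]
    \<chi>_\<delta>[THEN arg_cong[of _ _ mor]] \<tau>_\<Gamma>[THEN arg_cong[of _ _ mor]]
    co_twisted[THEN arg_cong[of _ _ mor]] co_cocycle[THEN arg_cong[of _ _ mor]]
    precounit[THEN arg_cong[of _ _ mor]]
  unfolding mor_simps words weak_crossed_coproduct_precounit_def mor_cp by (simp add: tobj_unit)

text \<open>The image of the idempotent is \<open>D\<close> itself, split by \<open>\<omega>\<close> and \<open>\<omega>'\<close>.\<close>

lemma crossed_biproduct:
  assumes "weak_bialgebra C D (mor \<eta>D) (mor \<mu>D) (mor \<epsilon>D) (mor \<delta>D)"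
  shows "weak_crossed_biproduct C D (mor \<eta>D) (mor \<mu>D) (mor \<epsilon>D) (mor \<delta>D) Q (mor \<epsilon>Q) (mor \<delta>Q)
    B (mor \<eta>B) (mor \<mu>B) (mor \<psi>) (mor \<sigma>) (mor \<chi>) (mor \<tau>) (mor \<nu>) (mor \<upsilon>)"
proof -
  have mult: "\<omega> \<bullet> \<mu>x \<bullet> (\<omega>' \<otimes> \<omega>') = \<mu>D"
  proof -
    have "\<omega> \<bullet> \<mu>x \<bullet> (\<omega>' \<otimes> \<omega>') = (\<omega> \<bullet> \<omega>') \<bullet> \<mu>D \<bullet> ((\<omega> \<bullet> \<omega>') \<otimes> (\<omega> \<bullet> \<omega>'))"
      unfolding \<mu>x_eq by (rule diagram_eqI) simp_all
    then show ?thesis by (simp add: \<omega>_\<omega>')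
  qed
  have comult: "(\<omega> \<otimes> \<omega>) \<bullet> \<delta>x \<bullet> \<omega>' = \<delta>D"
  proof -
    have "(\<omega> \<otimes> \<omega>) \<bullet> \<delta>x \<bullet> \<omega>' = ((\<omega> \<bullet> \<omega>') \<otimes> (\<omega> \<bullet> \<omega>')) \<bullet> \<delta>D \<bullet> (\<omega> \<bullet> \<omega>')"
      unfolding \<delta>x_eq by (rule diagram_eqI) simp_all
    then show ?thesis by (simp add: \<omega>_\<omega>')
  qed
  have homs: "mor \<omega> \<in> hom C (tobj C Q B) D" "mor \<omega>' \<in> hom C D (tobj C Q B)"
    "mor \<eta>D \<in> hom C (unit C) D" "mor \<mu>D \<in> hom C (tobj C D D) D" "mor \<epsilon>D \<in> hom C D (unit C)"
    "mor \<delta>D \<in> hom C D (tobj C D D)"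
    using \<omega>_hom(1,2)[THEN whomD(4)] D.\<eta>_hom[THEN whomD(4)] D.\<mu>_hom[THEN whomD(4)]
      D.\<epsilon>_hom[THEN whomD(4)] D.\<delta>_hom[THEN whomD(4)] by (simp_all add: tobj_unit)
  have idD: "idm C D \<in> hom C D D" by (simp add: hom_def idm_arr)
  have id_comp: "comp C (idm C D) a = a" if "a \<in> hom C A D" for a A
    using that idm_left by (auto simp: hom_def)
  have comp_id: "comp C a (idm C D) = a" if "a \<in> hom C D A" for a A
    using that idm_right by (auto simp: hom_def)
  have id_tens: "tarr C (idm C D) (idm C D) = idm C (tobj C D D)"
    by (rule tarr_idm)
  have id_tens_comp: "comp C (idm C (tobj C D D)) (mor \<delta>D) = mor \<delta>D"
    "comp C (mor \<mu>D) (idm C (tobj C D D)) = mor \<mu>D"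
    using homs idm_left[of "mor \<delta>D"] idm_right[of "mor \<mu>D"] by (auto simp: hom_def)
  have split: "comp C (mor \<omega>') (mor \<omega>) = nabla C Q B (mor \<eta>B) (mor \<mu>B) (mor \<psi>)"
    "comp C (mor \<omega>) (mor \<omega>') = idm C D"
    using nab_eq[THEN arg_cong[of _ _ mor]] \<omega>_\<omega>'[THEN arg_cong[of _ _ mor]]
    by (simp_all add: mor_nab tobj_unit)
  have alg: "algebra_morphism C D (comp C (mor \<omega>) (mor \<nu>))
      (comp C (mor \<omega>) (comp C (mu_cp C Q B (mor \<mu>B) (mor \<psi>) (mor \<sigma>)) (tarr C (mor \<omega>') (mor \<omega>'))))
      D (mor \<eta>D) (mor \<mu>D) (idm C D)"
    using \<omega>_cancel(3)[THEN arg_cong[of _ _ mor]] mult[THEN arg_cong[of _ _ mor]] homs idD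
    unfolding algebra_morphism_def mor_simps mor_cp
    by (simp add: id_comp id_tens id_tens_comp)
  have coalg: "coalgebra_morphism C D (comp C (mor \<upsilon>) (mor \<omega>'))
      (comp C (tarr C (mor \<omega>) (mor \<omega>)) (comp C (delta_cp C Q B (mor \<delta>Q) (mor \<chi>) (mor \<tau>)) (mor \<omega>')))
      D (mor \<epsilon>D) (mor \<delta>D) (idm C D)"
    using \<omega>'_cancel(3)[THEN arg_cong[of _ _ mor]] comult[THEN arg_cong[of _ _ mor]] homs idD
    unfolding coalgebra_morphism_def mor_simps mor_cp
    by (simp add: comp_id id_tens id_tens_comp)
  have "nabla C Q B (mor \<eta>B) (mor \<mu>B) (mor \<psi>) = Gamma C Q B (mor \<epsilon>Q) (mor \<delta>Q) (mor \<chi>)"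
    using nab_\<Gamma> by (simp flip: mor_nab mor_\<Gamma>)
  moreover have "comp C (tarr C (mor \<epsilon>Q) (idm C B)) (mor \<nu>) = mor \<eta>B"
    "comp C (mor \<upsilon>) (tarr C (idm C Q) (mor \<eta>B)) = mor \<epsilon>Q"
    using \<epsilon>Q_\<nu>[THEN arg_cong[of _ _ mor]] \<upsilon>_\<eta>[THEN arg_cong[of _ _ mor]]
    by (simp_all add: tobj_unit)
  \<comment> \<open>With \<open>\<omega>\<close> as projection and \<open>\<omega>'\<close> as
    injection, the transported structure is literally that of \<open>D\<close>, so \<open>w\<close>
    and \<open>w'\<close> are identities.\<close>
  moreover have "\<exists>P p i w w'. p \<in> hom C (tobj C Q B) P \<and> i \<in> hom C P (tobj C Q B) \<and>
      comp C i p = nabla C Q B (mor \<eta>B) (mor \<mu>B) (mor \<psi>) \<and> comp C p i = idm C P \<and>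
      w \<in> hom C P D \<and> w' \<in> hom C D P \<and> comp C w' w = idm C P \<and> comp C w w' = idm C D \<and>
      algebra_morphism C P (comp C p (mor \<nu>))
        (comp C p (comp C (mu_cp C Q B (mor \<mu>B) (mor \<psi>) (mor \<sigma>)) (tarr C i i))) D (mor \<eta>D) (mor \<mu>D) w \<and>
      coalgebra_morphism C P (comp C (mor \<upsilon>) i)
        (comp C (tarr C p p) (comp C (delta_cp C Q B (mor \<delta>Q) (mor \<chi>) (mor \<tau>)) i)) D (mor \<epsilon>D) (mor \<delta>D) w"
    by (rule exI[of _ D], rule exI[of _ "mor \<omega>"], rule exI[of _ "mor \<omega>'"], rule exI[of _ "idm C D"],
        rule exI[of _ "idm C D"]) (use homs idD split alg coalg id_comp[OF idD] in simp)
  ultimately show ?thesis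
    unfolding weak_crossed_biproduct_def
    using assms coalgebra_Q algebra_B crossed_product crossed_coproduct by blast
qed

end

section \<open>Passing from arrows of the category to word-typed arrows\<close>

context strict_braided_cat
begin

lemma Warr_hom: "Warr u a v \<in> whom u' v' \<longleftrightarrow> u = u' \<and> v = v' \<and> a \<in> hom C (word u) (word v)"
  by (auto simp: whom_def)

text \<open>By \<open>warr_eqI\<close> each equation splits into equalities of words, settled by
  computation, and an equation of underlying arrows, which is an axiom up to strict unit
  laws.\<close>

lemma weak_bialgebra_wordsI:
  assumes "weak_bialgebra C X eta mu eps delta"
  shows "weak_bialgebra_words C X
    (Warr [] eta [X]) (Warr [X, X] mu [X]) (Warr [X] eps []) (Warr [X] delta [X, X])"
  by (unfold_locales; (rule warr_eqI)?; simp add: Warr_hom tobj_unit)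
    (use assms[unfolded weak_bialgebra_def algebra_def coalgebra_def] in \<open>simp only:\<close>)+

lemma weak_hopf_wordsI:
  assumes "weak_hopf_algebra C X eta mu eps delta lam"
  shows "weak_hopf_words C X
    (Warr [] eta [X]) (Warr [X, X] mu [X]) (Warr [X] eps []) (Warr [X] delta [X, X]) (Warr [X] lam [X])"
proof -
  interpret weak_bialgebra_words C X
    "Warr [] eta [X]" "Warr [X, X] mu [X]" "Warr [X] eps []" "Warr [X] delta [X, X]"
    using assms by (intro weak_bialgebra_wordsI) (simp add: weak_hopf_algebra_def)
  have mor_Pi: "mor PiL_w = PiL C X eta mu eps delta" "mor PiR_w = PiR C X eta mu eps delta"
    by (simp_all add: PiL_w_def PiR_w_def PiL_def PiR_def \<kappa>_def tobj_unit)
  show ?thesis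
    by (unfold_locales; (rule warr_eqI)?; simp add: Warr_hom tobj_unit mor_Pi)
      (use assms[unfolded weak_hopf_algebra_def conv_def] in metis)+
qed

end

theorem theorem3p9:
  fixes C :: "('o, 'm) bcat"
    and D B DB :: 'o
    and etaD muD epsD deltaD etaB muB epsB deltaB lamB f g p i :: 'm
  assumes cat: "strict_braided_cat C"
    and wp: "weak_projection C D etaD muD epsD deltaD B etaB muB epsB deltaB lamB f g"
    and p_hom: "p \<in> hom C D DB"
    and i_hom: "i \<in> hom C DB D"
    and split_t: "comp C i p = comp C muD (comp C (tarr C (idm C D) (comp C f (comp C lamB g))) deltaD)"
    and p_i: "comp C p i = idm C DB"
  defines "epsDB \<equiv> comp C epsD i"
    and "deltaDB \<equiv> comp C (tarr C p p) (comp C deltaD i)"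
    and "psi \<equiv> comp C (tarr C p g) (comp C deltaD (comp C muD (tarr C f i)))"
    and "sigma \<equiv> comp C (tarr C p g) (comp C deltaD (comp C muD (tarr C i i)))"
    and "chi \<equiv> comp C (tarr C g p) (comp C deltaD (comp C muD (tarr C i f)))"
    and "tau \<equiv> comp C (tarr C g g) (comp C deltaD (comp C muD (tarr C i f)))"
    and "nu \<equiv> comp C (tarr C p g) (comp C deltaD etaD)"
    and "ups \<equiv> comp C epsD (comp C muD (tarr C i f))"
  shows "weak_crossed_biproduct C D etaD muD epsD deltaD DB epsDB deltaDB B etaB muB
           psi sigma chi tau nu ups
       \<and> comp C (delta_cp C DB B deltaDB chi tau) (beta_nu C DB B muB nu)
           = comp C (tarr C (beta_nu C DB B muB nu) (beta_nu C DB B muB nu)) deltaB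
       \<and> tau = comp C (tarr C epsDB deltaB) (nabla C DB B etaB muB psi)
       \<and> ups = comp C (tarr C epsDB epsB) (nabla C DB B etaB muB psi)"
proof -
  interpret strict_braided_cat C by (fact cat)
  note wp' = wp[unfolded weak_projection_def]
  interpret D: weak_bialgebra_words C D
    "Warr [] etaD [D]" "Warr [D, D] muD [D]" "Warr [D] epsD []" "Warr [D] deltaD [D, D]"
    using wp' by (intro weak_bialgebra_wordsI) simp
  interpret B: weak_hopf_words C B
    "Warr [] etaB [B]" "Warr [B, B] muB [B]" "Warr [B] epsB []" "Warr [B] deltaB [B, B]" "Warr [B] lamB [B]"
    using wp' by (intro weak_hopf_wordsI) simp
  interpret weak_projection_words C D
    "Warr [] etaD [D]" "Warr [D, D] muD [D]" "Warr [D] epsD []" "Warr [D] deltaD [D, D]" B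
    "Warr [] etaB [B]" "Warr [B, B] muB [B]" "Warr [B] epsB []" "Warr [B] deltaB [B, B]" "Warr [B] lamB [B]"
    "Warr [B] f [D]" "Warr [D] g [B]" "Warr [D] p [DB]" "Warr [DB] i [D]" DB
    by (unfold_locales; (rule warr_eqI)?)
      (use wp' p_hom i_hom split_t p_i in
        \<open>simp_all add: algebra_morphism_def coalgebra_morphism_def Warr_hom tobj_unit\<close>)
  \<comment> \<open>After unfolding, the word-level morphisms are syntactically the composites fixed
    in the theorem.\<close>
  have mors: "mor \<epsilon>Q = epsDB" "mor \<delta>Q = deltaDB" "mor \<psi> = psi" "mor \<sigma> = sigma" "mor \<chi> = chi"
    "mor \<tau> = tau" "mor \<nu> = nu" "mor \<upsilon> = ups"
    unfolding \<epsilon>Q_def \<delta>Q_def \<psi>_def \<sigma>_def \<chi>_def \<tau>_def \<nu>_def \<upsilon>_def epsDB_def deltaDB_def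
      psi_def sigma_def chi_def tau_def nu_def ups_def mor_simps warr.sel by (rule refl)+
  show ?thesis
    using crossed_biproduct wp' \<delta>x_\<beta>[THEN arg_cong[of _ _ mor]] \<tau>_eq_nab[THEN arg_cong[of _ _ mor]]
      \<upsilon>_eq_nab[THEN arg_cong[of _ _ mor]]
    unfolding mor_simps mor_\<delta>x mor_\<beta> mor_nab mors warr.sel by blast
qed

end
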